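(* Let $\alpha\in(1,2]$, $\sigma>0$, $u>0$, $S>0$, $K>0$, $r\in\mathbb{R}$, $\tau>0$, let $X_t\sim L(0,\sigma^\alpha,-1)$, and put $\mu=\sigma^\alpha/\cos\frac{\pi\alpha}{2}$ and $k_u:=\log\frac{S}{K^{1/u}}+r\tau$. The value of the digital power asset-or-nothing call option, i.e. the option with payoff $\mathcal{P}^{(A/N)}(S_T,K)=S_T^u\,\mathbf{1}_{\{S_T^u-K>0\}}$, is $$C_\alpha^{(A/N)}(S,K,r,\mu,\tau)=\frac{K e^{-r\tau}}{\alpha}\sum_{n=0}^\infty\sum_{m=0}^\infty\frac{1}{n!\,\Gamma\left(1+\frac{m-n}{\alpha}\right)}\,u^m\,(k_u+\mu\tau)^n\,(-\mu\tau)^{\frac{m-n}{\alpha}}.$$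
   Context: The process $X_t\sim L(0,\sigma^\alpha,-1)$ is the spectrally negative $\alpha$-stable Lévy process with characteristic function $\mathbb{E}[e^{ikX_t}]=\exp\left(-t\,\sigma^\alpha|k|^\alpha\left(1+i\tan\frac{\alpha\pi}{2}\,\mathrm{sgn}\,k\right)\right)$ for $k\in\mathbb{R}$; equivalently $\mathbb{E}[e^{pX_t}]=e^{-\mu t p^\alpha}$ for $p>0$, with $\mu=\sigma^\alpha/\cos\frac{\pi\alpha}{2}<0$. The asset price at maturity is $S_T=S\,e^{(r+\mu)\tau+X_\tau}$, where $\tau$ is the time-to-maturity, and the value of an option with payoff $\mathcal{P}(S_T,K)$ is $e^{-r\tau}\,\mathbb{E}\left[\mathcal{P}\left(Se^{(r+\mu)\tau+X_\tau},K\right)\right]$. Conventions: $1/\Gamma(z)=0$ when $z$ is a non-positive integer, and $0^0=1$. *)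

theory Defs
  imports "HOL-Probability.Probability"
begin

text \<open>Path regularity is not required: every process as below has a cadlag modification with
  the same marginal laws.\<close>

locale levy_process = prob_space M for M :: "'a measure" +
  fixes X :: "real \<Rightarrow> 'a \<Rightarrow> real"
  assumes measurable_X: "\<And>t. t \<ge> 0 \<Longrightarrow> X t \<in> borel_measurable M"
    and start_zero: "AE \<omega> in M. X 0 \<omega> = 0"
    and independent_increments:
      "\<And>(s :: nat \<Rightarrow> real) n. s 0 \<ge> 0 \<Longrightarrow> mono s \<Longrightarrow>
         indep_vars (\<lambda>_. borel) (\<lambda>i \<omega>. X (s (Suc i)) \<omega> - X (s i) \<omega>) {..<n}"
    and stationary_increments:
      "\<And>s h. s \<ge> 0 \<Longrightarrow> h \<ge> 0 \<Longrightarrow>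
         distr M borel (\<lambda>\<omega>. X (s + h) \<omega> - X s \<omega>) = distr M borel (\<lambda>\<omega>. X h \<omega> - X 0 \<omega>)"
    and stochastically_continuous:
      "\<And>s \<epsilon>. s \<ge> 0 \<Longrightarrow> \<epsilon> > 0 \<Longrightarrow>
         ((\<lambda>t. prob {\<omega> \<in> space M. \<bar>X t \<omega> - X s \<omega>\<bar> > \<epsilon>}) \<longlongrightarrow> 0) (at s within {0..})"

text \<open>The process $L(0, \sigma^\alpha, -1)$: centred, totally negatively skewed stable.\<close>

locale spectrally_negative_stable_process = levy_process M X
  for M :: "'a measure" and X :: "real \<Rightarrow> 'a \<Rightarrow> real" +
  fixes \<alpha> \<sigma> :: real
  assumes char_X:
    "\<And>t k. t \<ge> 0 \<Longrightarrow>
       char (distr M borel (X t)) k =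
         exp (- complex_of_real (t * \<sigma> powr \<alpha> * \<bar>k\<bar> powr \<alpha>)
              * (1 + \<i> * complex_of_real (tan (\<alpha> * pi / 2) * sgn k)))"

definition asset_price ::
    "(real \<Rightarrow> 'a \<Rightarrow> real) \<Rightarrow> real \<Rightarrow> real \<Rightarrow> real \<Rightarrow> real \<Rightarrow> 'a \<Rightarrow> real" where
  "asset_price X S r \<mu> \<tau> \<omega> = S * exp ((r + \<mu>) * \<tau> + X \<tau> \<omega>)"

definition option_value ::
    "'a measure \<Rightarrow> (real \<Rightarrow> 'a \<Rightarrow> real) \<Rightarrow> (real \<Rightarrow> real \<Rightarrow> real) \<Rightarrow>
     real \<Rightarrow> real \<Rightarrow> real \<Rightarrow> real \<Rightarrow> real \<Rightarrow> real" where
  "option_value M X P S K r \<mu> \<tau> =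
     exp (- r * \<tau>) * (\<integral>\<omega>. P (asset_price X S r \<mu> \<tau> \<omega>) K \<partial>M)"

definition power_asset_or_nothing_call :: "real \<Rightarrow> real \<Rightarrow> real \<Rightarrow> real" where
  "power_asset_or_nothing_call u s K = (if s powr u - K > 0 then s powr u else 0)"

end

theory Submission
  imports Defs "HOL-Complex_Analysis.Complex_Analysis" "HOL-Real_Asymp.Real_Asymp"
begin

text \<open>
  Write $c = -\mu\tau > 0$ and $y = k_u + \mu\tau$. The payoff is $K e^{u(X+y)} 1_{X+y>0}$, and
  $X = X_\tau$ has characteristic function $k \mapsto \exp(c\,(ik)^\alpha)$. By the Levy inversion
  formula, with the line of integration moved from the imaginary axis to $\mathrm{Re}\,p = \gamma > u$,
  \[ P(X > a) = \frac{1}{2\pi i} \int_{\mathrm{Re}\,p = \gamma} e^{c p^\alpha - a p}\, \frac{dp}{p}. \]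
  Integrating the tail against $u e^{u w}$ turns the option value, up to the factor $K e^{-r\tau}$, into
  $\frac{1}{2\pi i} \int e^{c p^\alpha + y p} (p - u)^{-1}\, dp$. Expanding $e^{y p}$ in powers of $y p$
  and $(p - u)^{-1}$ in powers of $u / p$ leaves the Hankel-type integrals
  $\frac{1}{2\pi i} \int e^{c p^\alpha} p^{-s}\, dp = \frac{1}{\alpha}\,
  c^{(s-1)/\alpha} / \Gamma(1 + \frac{s-1}{\alpha})$ with $s = m + 1 - n$. For $s < 1$ they are computed by
  rotating the contour to the rays $\arg p = \pm\pi/\alpha$, for $s > 1$ by the recurrence that
  integration by parts gives, and at $s = 1$ by continuity.
\<close>

subsection \<open>Decay of the moment generating function in a sector\<close>

text \<open>Convergence rests on one fact: since \<alpha> > 1, the factor e^(c p^\<alpha>) beats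
  e^(-A |p|) for every A where Re p is bounded above and |arg p| is at most pi/\<alpha>. It absorbs
  e^(y p), every power of p and the expansions made under the integral sign. The obstacles sit at p
  = 0. The inversion kernel has a simple pole there; it cancels in P(a < X <= b), so the line is
  moved for such differences, and b goes to infinity only on Re p = \<gamma>, where e^(-b p) becomes
  small. The factor p^(-s) is singular at 0 as well, and rays that end at the origin can carry it
  only for s < 1; hence the separate treatment of larger s. The condition \<gamma> > u enters twice:
  the tail is of order e^(-\<gamma> w), hence integrable against e^(u w), and |u / p| \<le> u /
  \<gamma> < 1 holds uniformly on the line.\<close>

definition stable_mgf :: "real \<Rightarrow> real \<Rightarrow> complex \<Rightarrow> complex" where
  "stable_mgf c \<alpha> p = exp (of_real c * p powr of_real \<alpha>)"

text \<open>Using Re p / Im p instead of Im p / Re p gives one formula across the imaginary axis,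
  monotone in the slope. Linear inequalities between Re p and Im p thereby become bounds on the
  argument.\<close>

lemma Arg_upper_half_plane:
  assumes "Im p > 0"
  shows "Arg p = pi / 2 - arctan (Re p / Im p)"
proof -
  have "p \<noteq> 0" using assms by auto
  consider "Re p = 0" | "Re p > 0" | "Re p < 0" by linarith
  then show ?thesis
  proof cases
    case 2
    with assms arctan_inverse[of "Im p / Re p"] show ?thesis
      using \<open>p \<noteq> 0\<close> by (simp add: Arg_eq_Im_Ln Im_Ln_eq inverse_eq_divide)
  next
    case 3
    then have "Im p / Re p < 0" using assms by (simp add: divide_pos_neg)
    then have "arctan (Re p / Im p) = - pi / 2 - arctan (Im p / Re p)"
      using arctan_inverse[of "- (Im p / Re p)"] by (simp add: arctan_minus)
    with 3 assms show ?thesis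
      using \<open>p \<noteq> 0\<close> by (simp add: Arg_eq_Im_Ln Im_Ln_eq)
  qed (use \<open>p \<noteq> 0\<close> assms in \<open>simp add: Arg_eq_Im_Ln Im_Ln_eq\<close>)
qed

text \<open>The modulus of an exponential depends on the real part of its exponent only, here c
  |p|^\<alpha> cos(\<alpha> Arg p). Growth or decay is thus decided by the sign of a cosine.\<close>

lemma norm_stable_mgf:
  "norm (stable_mgf c \<alpha> p) = exp (c * (norm p powr \<alpha> * cos (\<alpha> * Arg p)))"
proof (cases "p = 0")
  case False
  then show ?thesis
    unfolding stable_mgf_def norm_exp_eq_Re
    by (simp add: powr_def Re_exp Arg_eq_Im_Ln)
qed (simp add: stable_mgf_def)

lemma cnj_stable_mgf:
  assumes "p \<notin> \<real>\<^sub>\<le>\<^sub>0"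
  shows "cnj (stable_mgf c \<alpha> p) = stable_mgf c \<alpha> (cnj p)"
proof -
  have "p \<noteq> 0" using assms by auto
  with assms show ?thesis
    by (simp add: stable_mgf_def exp_cnj powr_def cnj_Ln)
qed

lemma norm_stable_mgf_le: 
  assumes "c \<ge> 0" shows "norm (stable_mgf c \<alpha> p) \<le> exp (c * norm p powr \<alpha>)"
  using assms by (simp add: norm_stable_mgf mult_left_le mult_left_mono)

lemma holomorphic_stable_mgf [holomorphic_intros]:
  "stable_mgf c \<alpha> holomorphic_on (- \<real>\<^sub>\<le>\<^sub>0)"
  unfolding stable_mgf_def by (intro holomorphic_intros) auto

text \<open>A superlinear power eventually dominates the linear term; before the crossover the
  linear term alone is bounded.\<close>

lemma linear_minus_powr_bounded:
  fixes A b \<alpha> :: real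
  assumes "b > 0" "\<alpha> > 1"
  obtains C where "\<And>r. r \<ge> 0 \<Longrightarrow> A * r - b * r powr \<alpha> \<le> C"
proof
  \<comment> \<open>The crossover point, where |A| = b R^(\<alpha> - 1).\<close>
  define R where "R = (\<bar>A\<bar> / b) powr (1 / (\<alpha> - 1))"
  fix r :: real assume r: "r \<ge> 0"
  show "A * r - b * r powr \<alpha> \<le> \<bar>A\<bar> * R"
  proof (cases "r \<le> R")
    case True
    have "A * r \<le> \<bar>A\<bar> * R" using True r by (intro mult_mono) auto
    moreover have "b * r powr \<alpha> \<ge> 0" using assms by simp
    ultimately show ?thesis by linarith
  next
    case False
    then have "r > 0" by (auto simp: R_def intro: le_less_trans[of 0 "R"])
    have "R powr (\<alpha> - 1) = \<bar>A\<bar> / b" using assms by (simp add: R_def powr_powr)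
    moreover have "R powr (\<alpha> - 1) \<le> r powr (\<alpha> - 1)"
      using False assms by (intro powr_mono2) (auto simp: R_def)
    ultimately have "\<bar>A\<bar> / b \<le> r powr (\<alpha> - 1)" by simp
    then have "\<bar>A\<bar> \<le> b * r powr (\<alpha> - 1)" using assms by (simp add: field_simps)
    then have "A * r \<le> b * r powr (\<alpha> - 1) * r"
      using \<open>r > 0\<close> by (intro mult_right_mono) auto
    also have "\<dots> = b * r powr \<alpha>" using \<open>r > 0\<close> by (simp add: powr_diff)
    finally have "A * r \<le> b * r powr \<alpha>" .
    moreover have "0 \<le> \<bar>A\<bar> * R" by (simp add: R_def)
    ultimately show ?thesis by linarith
  qed
qed

text \<open>The cotangent of $\pi/\alpha$: on the ray with this argument $p^\alpha$ is a negative real.\<close>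

definition sector_slope :: "real \<Rightarrow> real" where
  "sector_slope \<alpha> = tan (pi / 2 - pi / \<alpha>)"

text \<open>The part of the plane between the rays through \<kappa> + i and \<kappa> - i on the left
  and a vertical line on the right. The absolute value makes it symmetric under conjugation, and its
  only point on the nonpositive real axis is the origin.\<close>

definition sector_region :: "real \<Rightarrow> real \<Rightarrow> complex set" where
  "sector_region \<kappa> \<gamma> = {p. \<kappa> * \<bar>Im p\<bar> \<le> Re p \<and> Re p \<le> \<gamma>}"

lemma sector_slope:
  assumes "1 < \<alpha>" "\<alpha> \<le> 2"
  shows "sector_slope \<alpha> \<le> 0" "arctan (sector_slope \<alpha>) = pi / 2 - pi / \<alpha>"
proof -
  have 1: "pi / \<alpha> \<ge> pi / 2" "pi / \<alpha> < pi" using assms by (auto simp: field_simps)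
  then have "tan (- (pi/2 - pi/\<alpha>)) \<ge> 0" by (intro tan_pos_pi2_le) linarith+
  then show "sector_slope \<alpha> \<le> 0" unfolding sector_slope_def by (simp only: tan_minus)
  show "arctan (sector_slope \<alpha>) = pi / 2 - pi / \<alpha>" unfolding sector_slope_def
    using 1 by (intro arctan_tan) linarith+
qed

text \<open>Far from the real axis the condition Re p \<le> \<gamma> forces the argument close to
  pi/2 or beyond, while the rays keep it at most pi/\<alpha>. Then \<alpha> Arg p lies in an
  interval [\<psi>, pi] with \<psi> > pi/2, where the cosine is uniformly negative. The rest of the
  region is bounded, and the lower half plane follows by conjugation.\<close>

lemma stable_mgf_bound:
  assumes "c > 0" "1 < \<alpha>" "\<alpha> \<le> 2" "\<gamma> > 0"
  obtains C where "C > 0"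
    "\<And>p. p \<in> sector_region (sector_slope \<alpha>) \<gamma> \<Longrightarrow> norm (stable_mgf c \<alpha> p) \<le> C * exp (- A * norm p)"
proof -
  define \<kappa> where "\<kappa> = sector_slope \<alpha>"
  have \<kappa>: "\<kappa> \<le> 0" "arctan \<kappa> = pi / 2 - pi / \<alpha>" using sector_slope assms by (auto simp: \<kappa>_def)
  \<comment> \<open>Half the gap between pi/2 and pi/(2 \<alpha>), the angle at which cos(\<alpha>
    Arg p) changes sign. It makes \<psi> = (\<alpha> + 1) pi / 4, strictly between pi/2 and
    pi.\<close>
  define \<delta> where "\<delta> = (pi / 2 - pi / (2 * \<alpha>)) / 2"
  have \<delta>: "0 < \<delta>" "\<delta> \<le> pi / 8"
    using assms by (auto simp: \<delta>_def field_simps)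
  have tan: "tan \<delta> > 0" using \<delta> pi_gt_zero by (intro tan_gt_zero) linarith+
  \<comment> \<open>The height at which the line Re p = \<gamma> meets the ray of argument pi/2 -
    \<delta>; above it every point left of the line has at least that argument.\<close>
  define t0 where "t0 = \<gamma> / tan \<delta>"
  have t0: "t0 > 0" using tan assms by (simp add: t0_def)
  define \<psi> where "\<psi> = \<alpha> * (pi / 2 - \<delta>)"
  have "\<alpha> * \<delta> = (\<alpha> * pi - pi) / 4" using assms by (simp add: \<delta>_def field_simps)
  then have "\<psi> = \<alpha> * pi / 4 + pi / 4" by (simp add: \<psi>_def field_simps)
  then have \<psi>_eq: "\<psi> = (\<alpha> + 1) / 4 * pi" by (simp add: field_simps)
  have \<psi>: "pi / 2 < \<psi>" "\<psi> < pi"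
    using mult_strict_right_mono[of "1 / 2" "(\<alpha> + 1) / 4" pi] mult_strict_right_mono[of "(\<alpha> + 1) / 4" 1 pi] assms
    unfolding \<psi>_eq by auto
  define \<eta> where "\<eta> = - cos \<psi>"
  have \<eta>: "\<eta> > 0" using \<psi> cos_lt_zero_pi[of \<psi>] by (simp add: \<eta>_def)
  obtain B where B: "\<And>r. r \<ge> 0 \<Longrightarrow> A * r - c * \<eta> * r powr \<alpha> \<le> B"
    using linear_minus_powr_bounded[of "c * \<eta>" \<alpha> A] assms \<eta> by auto
  \<comment> \<open>Bounds the modulus of all points of the region with |Im p| \<le>
    \<open>t0\<close>, for which -|\<kappa>| \<open>t0\<close> \<le> Re p \<le> \<gamma>.\<close>
  define R where "R = t0 + \<gamma> + \<bar>\<kappa>\<bar> * t0"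
  define C where "C = max (exp B) (exp (c * R powr \<alpha> + \<bar>A\<bar> * R))"
  have upper: "norm (stable_mgf c \<alpha> p) \<le> exp B * exp (- A * norm p)"
    if p: "Im p \<ge> t0" "\<kappa> * Im p \<le> Re p" "Re p \<le> \<gamma>" for p
  proof -
    have im: "Im p > 0" using p t0 by auto
    have "Re p / Im p \<le> \<gamma> / t0" using p t0 assms im
      by (smt (verit) frac_le divide_nonpos_pos divide_nonneg_pos)
    also have "\<dots> = tan \<delta>" using assms tan by (simp add: t0_def)
    finally have "arctan (Re p / Im p) \<le> arctan (tan \<delta>)" by (simp add: arctan_le_iff)
    also have "\<dots> = \<delta>" using \<delta> pi_gt_zero by (intro arctan_tan) linarith+
    finally have a1: "Arg p \<ge> pi / 2 - \<delta>" using im by (simp add: Arg_upper_half_plane)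
    have "\<kappa> \<le> Re p / Im p" using p im by (simp add: field_simps)
    then have "arctan \<kappa> \<le> arctan (Re p / Im p)" by (simp add: arctan_le_iff)
    then have a2: "Arg p \<le> pi / \<alpha>" using im \<kappa> by (simp add: Arg_upper_half_plane)
    have "cos (\<alpha> * Arg p) \<le> cos \<psi>"
    proof (rule cos_monotone_0_pi_le)
      show "0 \<le> \<psi>" using \<psi> pi_gt_zero by linarith
      show "\<psi> \<le> \<alpha> * Arg p" using a1 assms by (simp add: \<psi>_def)
      show "\<alpha> * Arg p \<le> pi" using a2 assms by (simp add: field_simps)
    qed
    then have "norm p powr \<alpha> * cos (\<alpha> * Arg p) \<le> norm p powr \<alpha> * (- \<eta>)"
      by (intro mult_left_mono) (auto simp: \<eta>_def)
    then have "c * (norm p powr \<alpha> * cos (\<alpha> * Arg p)) \<le> c * (norm p powr \<alpha> * (- \<eta>))"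
      by (rule mult_left_mono) (use assms in simp)
    also have "\<dots> \<le> B - A * norm p" using B[of "norm p"] by (simp add: algebra_simps)
    finally show ?thesis unfolding norm_stable_mgf by (simp add: exp_diff exp_minus field_simps flip: exp_add)
  qed
  show thesis
  proof
    show "C > 0" by (auto simp: C_def max_def)
    fix p assume "p \<in> sector_region (sector_slope \<alpha>) \<gamma>"
    then have p: "\<kappa> * \<bar>Im p\<bar> \<le> Re p" "Re p \<le> \<gamma>" by (auto simp: sector_region_def \<kappa>_def)
    consider "Im p \<ge> t0" | "Im p \<le> - t0" | "\<bar>Im p\<bar> \<le> t0" by linarith
    then show "norm (stable_mgf c \<alpha> p) \<le> C * exp (- A * norm p)"
    proof cases
      case 1
      then have "norm (stable_mgf c \<alpha> p) \<le> exp B * exp (- A * norm p)" using p t0 by (intro upper) auto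
      also have "\<dots> \<le> C * exp (- A * norm p)" by (intro mult_right_mono) (auto simp: C_def)
      finally show ?thesis .
    next
      case 2
      then have "p \<notin> \<real>\<^sub>\<le>\<^sub>0" using t0 by (auto simp: complex_nonpos_Reals_iff)
      then have "norm (stable_mgf c \<alpha> p) = norm (stable_mgf c \<alpha> (cnj p))"
        by (metis cnj_stable_mgf complex_mod_cnj)
      also have "\<dots> \<le> exp B * exp (- A * norm (cnj p))" using p t0 2 by (intro upper) auto
      also have "\<dots> = exp B * exp (- A * norm p)" by simp
      also have "\<dots> \<le> C * exp (- A * norm p)" by (intro mult_right_mono) (auto simp: C_def)
      finally show ?thesis .
    next
      case 3
      have "\<bar>\<kappa>\<bar> * \<bar>Im p\<bar> \<le> \<bar>\<kappa>\<bar> * t0" using 3 by (intro mult_left_mono) auto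
      then have "\<bar>Re p\<bar> \<le> \<gamma> + \<bar>\<kappa>\<bar> * t0"
        using \<kappa>(1) p assms(4) mult_nonneg_nonneg[of "\<bar>\<kappa>\<bar>" t0] t0 abs_of_nonpos[of \<kappa>] by simp
      then have nR: "norm p \<le> R" using cmod_le[of p] 3 by (simp add: R_def)
      have "norm (stable_mgf c \<alpha> p) \<le> exp (c * norm p powr \<alpha>)"
        using assms by (intro norm_stable_mgf_le) auto
      also have "c * norm p powr \<alpha> \<le> c * R powr \<alpha>"
        using assms nR by (intro mult_left_mono powr_mono2) auto
      also have "\<dots> \<le> (c * R powr \<alpha> + \<bar>A\<bar> * R) - A * norm p"
      proof -
        have "A * norm p \<le> \<bar>A\<bar> * R" using nR by (intro mult_mono) auto
        then show ?thesis by simp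
      qed
      finally have "norm (stable_mgf c \<alpha> p) \<le> exp (c * R powr \<alpha> + \<bar>A\<bar> * R) * exp (- A * norm p)"
        by (simp flip: exp_add)
      also have "\<dots> \<le> C * exp (- A * norm p)" by (intro mult_right_mono) (auto simp: C_def)
      finally show ?thesis .
    qed
  qed
qed

subsection \<open>Moving a vertical line to a pair of rays\<close>

lemma tendsto_integral_symmetric_interval:
  fixes f :: "real \<Rightarrow> complex"
  assumes "integrable lborel f"
  shows "(\<lambda>n. \<integral>x. indicator {- real n..real n} x *\<^sub>R f x \<partial>lborel) \<longlonglongrightarrow> (\<integral>x. f x \<partial>lborel)"
proof (rule integral_dominated_convergence[where w = "\<lambda>x. norm (f x)"])
  show "AE x in lborel. (\<lambda>n. indicator {- real n..real n} x *\<^sub>R f x) \<longlonglongrightarrow> f x"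
  proof (rule AE_I2, rule tendsto_eventually)
    fix x :: real
    obtain N where "\<bar>x\<bar> \<le> real N" using real_arch_simple by blast
    then show "\<forall>\<^sub>F n in sequentially. indicator {- real n..real n} x *\<^sub>R f x = f x"
      by (intro eventually_sequentiallyI[of N]) (auto simp: indicator_def)
  qed
qed (use assms in \<open>auto split: split_indicator\<close>)

text \<open>The truncation stays away from 0 as well as from infinity, because along a ray the
  integrand may be singular at the origin and a primitive need not exist there.\<close>

lemma tendsto_integral_positive_interval:
  fixes f :: "real \<Rightarrow> complex"
  assumes "set_integrable lborel {0<..} f"
  shows "(\<lambda>n. \<integral>x. indicator {1 / Suc n..Suc n} x *\<^sub>R f x \<partial>lborel) \<longlonglongrightarrow> (\<integral>x\<in>{0<..}. f x \<partial>lborel)"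
  unfolding set_lebesgue_integral_def
proof (rule integral_dominated_convergence[where w = "\<lambda>x. norm (indicator {0<..} x *\<^sub>R f x)"])
  have m: "(\<lambda>x. indicator {0<..} x *\<^sub>R f x) \<in> borel_measurable lborel"
    using assms by (auto simp: set_integrable_def)
  then show "(\<lambda>x. indicator {0<..} x *\<^sub>R f x) \<in> borel_measurable lborel" .
  fix n
  have "(\<lambda>x. indicator {1 / Suc n..Suc n} x *\<^sub>R (indicator {0<..} x *\<^sub>R f x)) \<in> borel_measurable lborel"
    using m by measurable
  \<comment> \<open>Only the restriction of f to the positive half-line is known to be measurable.
    The compact interval lies inside that half-line, so the restriction can be inserted at no
    cost.\<close>
  moreover have *: "indicator {1 / Suc n..Suc n} x *\<^sub>R (indicator {0<..} x *\<^sub>R f x)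
      = indicator {1 / Suc n..Suc n} x *\<^sub>R f x" for x
    using less_le_trans[of 0 "1 / Suc n" x] by (auto split: split_indicator)
  ultimately show "(\<lambda>x. indicator {1 / Suc n..Suc n} x *\<^sub>R f x) \<in> borel_measurable lborel" by (simp only: *)
  show "AE x in lborel. norm (indicator {1 / Suc n..Suc n} x *\<^sub>R f x) \<le> norm (indicator {0<..} x *\<^sub>R f x)"
    unfolding *[symmetric] by (auto split: split_indicator)
next
  show "AE x in lborel. (\<lambda>n. indicator {1 / Suc n..Suc n} x *\<^sub>R f x) \<longlonglongrightarrow> indicator {0<..} x *\<^sub>R f x"
  proof (rule AE_I2, rule tendsto_eventually)
    fix x :: real
    show "\<forall>\<^sub>F n in sequentially. indicator {1 / Suc n..Suc n} x *\<^sub>R f x = indicator {0<..} x *\<^sub>R f x"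
    proof (cases "x > 0")
      case True
      obtain N where N: "max x (1 / x) \<le> real N" using real_arch_simple by blast
      show ?thesis
      proof (rule eventually_sequentiallyI[of N])
        fix n assume "N \<le> n"
        then have "x \<le> Suc n" "1 / x \<le> Suc n" using N by auto
        then show "indicator {1 / Suc n..Suc n} x *\<^sub>R f x = indicator {0<..} x *\<^sub>R f x"
          using True by (auto simp: indicator_def field_simps)
      qed
    next
      case False
      then have "x \<notin> {1 / Suc n..Suc n}" for n
        using less_le_trans[of 0 "1 / Suc n" x] by auto
      then show ?thesis using False by simp
    qed
  qed
  show "integrable lborel (\<lambda>x. norm (indicator {0<..} x *\<^sub>R f x))"
    using assms unfolding set_integrable_def by (rule integrable_norm)
qed

text \<open>Along p = \<gamma> + i k one has dp = i dk, which is the source of the factor i.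
  Integrability turns the truncated integrals into the full one.\<close>

lemma vertical_line_FTC:
  fixes \<Phi> F :: "complex \<Rightarrow> complex"
  assumes deriv: "\<And>k. (\<Phi> has_field_derivative F (Complex \<gamma> k)) (at (Complex \<gamma> k))"
    and cont: "continuous_on UNIV (\<lambda>k. F (Complex \<gamma> k))"
    and int: "integrable lborel (\<lambda>k. F (Complex \<gamma> k))"
  shows "(\<lambda>n. \<Phi> (Complex \<gamma> (real n)) - \<Phi> (Complex \<gamma> (- real n)))
           \<longlonglongrightarrow> \<i> * (\<integral>k. F (Complex \<gamma> k) \<partial>lborel)"
proof -
  have "(\<integral>k. indicator {- real n..real n} k *\<^sub>R (\<i> * F (Complex \<gamma> k)) \<partial>lborel)
      = \<Phi> (Complex \<gamma> (real n)) - \<Phi> (Complex \<gamma> (- real n))" for n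
  proof (rule integral_FTC_Icc[where F = "\<lambda>k. \<Phi> (Complex \<gamma> k)"])
    fix k
    have "((\<lambda>k. Complex \<gamma> k) has_vector_derivative \<i>) (at k within {- real n..real n})"
      unfolding Complex_eq by (auto intro!: derivative_eq_intros simp: has_vector_derivative_def scaleR_conv_of_real)
    then show "((\<lambda>k. \<Phi> (Complex \<gamma> k)) has_vector_derivative \<i> * F (Complex \<gamma> k)) (at k within {- real n..real n})"
      using field_vector_diff_chain_within[of "\<lambda>k. Complex \<gamma> k" \<i> k _ \<Phi>, OF _ has_field_derivative_at_within[OF deriv]]
      by (simp add: o_def)
  qed (use cont in \<open>auto intro!: continuous_intros intro: continuous_on_subset\<close>)
  moreover have "(\<lambda>n. \<integral>k. indicator {- real n..real n} k *\<^sub>R (\<i> * F (Complex \<gamma> k)) \<partial>lborel)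
      \<longlonglongrightarrow> (\<integral>k. \<i> * F (Complex \<gamma> k) \<partial>lborel)"
    using int by (intro tendsto_integral_symmetric_interval) auto
  ultimately show ?thesis by simp
qed

lemma ray_FTC:
  fixes \<Phi> F :: "complex \<Rightarrow> complex"
  assumes deriv: "\<And>t. t > 0 \<Longrightarrow> (\<Phi> has_field_derivative F (of_real t * w)) (at (of_real t * w))"
    and cont: "continuous_on {0<..} (\<lambda>t. F (of_real t * w))"
    and int: "set_integrable lborel {0<..} (\<lambda>t. F (of_real t * w))"
  shows "(\<lambda>n. \<Phi> (of_real (Suc n) * w) - \<Phi> (of_real (1 / Suc n) * w))
           \<longlonglongrightarrow> w * (\<integral>t\<in>{0<..}. F (of_real t * w) \<partial>lborel)"
proof -
  have "(\<integral>t. indicator {1 / Suc n..Suc n} t *\<^sub>R (w * F (of_real t * w)) \<partial>lborel)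
      = \<Phi> (of_real (Suc n) * w) - \<Phi> (of_real (1 / Suc n) * w)" for n
  proof (rule integral_FTC_Icc[where F = "\<lambda>t. \<Phi> (of_real t * w)"])
    fix t assume "1 / real (Suc n) \<le> t"
    then have "t > 0" using less_le_trans[of 0 "1 / Suc n" t] by auto
    have "((\<lambda>t. of_real t * w) has_vector_derivative w) (at t within {1 / Suc n..Suc n})"
      by (auto intro!: derivative_eq_intros simp: has_vector_derivative_def scaleR_conv_of_real)
    then show "((\<lambda>t. \<Phi> (of_real t * w)) has_vector_derivative w * F (of_real t * w)) (at t within {1 / Suc n..Suc n})"
      using field_vector_diff_chain_within[of "\<lambda>t. of_real t * w" w t _ \<Phi>, OF _ has_field_derivative_at_within[OF deriv]] \<open>t > 0\<close>
      by (simp add: o_def)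
  next
    have "{1 / real (Suc n)..real (Suc n)} \<subseteq> {0<..}"
      using less_le_trans[of 0 "1 / Suc n"] by auto
    then show "continuous_on {1 / real (Suc n)..real (Suc n)} (\<lambda>t. w * F (of_real t * w))"
      using cont by (intro continuous_intros) (rule continuous_on_subset)
  qed (simp add: field_simps)
  moreover have "(\<lambda>n. \<integral>t. indicator {1 / Suc n..Suc n} t *\<^sub>R (w * F (of_real t * w)) \<partial>lborel)
      \<longlonglongrightarrow> (\<integral>t\<in>{0<..}. w * F (of_real t * w) \<partial>lborel)"
    using int by (intro tendsto_integral_positive_interval) auto
  ultimately show ?thesis by simp
qed

section \<open>Integrable majorants\<close>

lemma Gamma_integral_real_Ioi:
  assumes "z > (0::real)"
  shows "((\<lambda>t. t powr (z - 1) * exp (- t)) has_integral Gamma z) {0<..}"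
proof -
  have "((\<lambda>t. t powr (z - 1) * exp (- t)) has_integral Gamma z) {0..}"
    using Gamma_integral_real[OF assms] by (simp add: exp_minus field_simps)
  then have "((\<lambda>t. if t \<in> {0<..} then t powr (z - 1) * exp (- t) else 0) has_integral Gamma z) {0..}"
    by (rule has_integral_spike [of "{0}", rotated 2]) auto
  then show ?thesis by (subst (asm) has_integral_restrict) auto
qed

text \<open>Nonnegativity upgrades the gauge integral of the Gamma function to Lebesgue
  integrability. This is the majorant on rays that start at the origin.\<close>

lemma powr_exp_integrable:
  assumes "s < (1::real)"
  shows "set_integrable lborel {0<..} (\<lambda>t::real. t powr (- s) * exp (- t))"
proof -
  have "(\<lambda>t. t powr (- s) * exp (- t)) integrable_on {0<..}"
    using Gamma_integral_real_Ioi[of "1 - s"] assms by (auto simp: integrable_on_def)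
  then have "(\<lambda>t. t powr (- s) * exp (- t)) absolutely_integrable_on {0<..}"
    by (intro nonnegative_absolutely_integrable_1) auto
  moreover have "(\<lambda>x. indicator {0<..} x *\<^sub>R (x powr (- s) * exp (- x))) \<in> borel_measurable borel"
    by measurable
  ultimately show ?thesis
    by (simp add: set_integrable_def integrable_completion)
qed

lemma exp_minus_abs_integrable: "integrable lborel (\<lambda>k::real. exp (- \<bar>k\<bar>))"
proof -
  have *: "set_integrable lborel {0<..} (\<lambda>t::real. exp (- t))"
    using powr_exp_integrable[of 0] by (rule set_integrable_cong[THEN iffD1, rotated 3]) auto
  have "integrable lborel (\<lambda>k::real. indicator {0<..} (- k) *\<^sub>R exp (- (- k)))"
    using * lborel_integrable_real_affine_iff[of "-1" "\<lambda>t. indicator {0<..} t *\<^sub>R exp (- t :: real)" 0]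
    by (simp add: set_integrable_def)
  then have "integrable lborel (\<lambda>k::real. indicator {0<..} k *\<^sub>R exp (- k) + indicator {0<..} (- k) *\<^sub>R exp (- (- k)))"
    using * by (auto simp: set_integrable_def)
  moreover have "AE k in lborel. indicator {0<..} k *\<^sub>R exp (- k) + indicator {0<..} (- k) *\<^sub>R exp (- (- k)) = exp (- \<bar>k::real\<bar>)"
    using AE_lborel_singleton[of 0] by eventually_elim (auto split: split_indicator)
  ultimately show ?thesis by (subst integrable_cong_AE[symmetric]) auto
qed

section \<open>Contour deformation in the slit plane\<close>

lemma starlike_slit_plane: "starlike (- \<real>\<^sub>\<le>\<^sub>0 :: complex set)"
proof -
  have "(\<real>\<^sub>\<le>\<^sub>0 :: complex set) = of_real ` {..0}" by (auto simp: nonpos_Reals_def)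
  then show ?thesis using starlike_slotted_complex_plane_left[of 0] by simp
qed

text \<open>The exponent s describes the singularity allowed at the origin: s < 1 keeps it
  integrable along the rays and makes the detour around the origin negligible, while s \<ge> 0 makes
  the bound decreasing in |p|, so that |p| may be replaced by any positive lower estimate.\<close>

locale sector_contour =
  fixes F :: "complex \<Rightarrow> complex" and \<gamma> \<kappa> s C :: real
  assumes hol: "F holomorphic_on (- \<real>\<^sub>\<le>\<^sub>0)"
    and \<gamma>_pos: "\<gamma> > 0" and \<kappa>_nonpos: "\<kappa> \<le> 0" and s: "0 \<le> s" "s < 1"
    and bound: "\<And>p. p \<in> sector_region \<kappa> \<gamma> \<Longrightarrow> p \<notin> \<real>\<^sub>\<le>\<^sub>0 \<Longrightarrow>
                  norm (F p) \<le> C * norm p powr (- s) * exp (- norm p)"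
begin

lemma C_nonneg: "C \<ge> 0"
proof -
  have "norm (F (of_real \<gamma>)) \<le> C * (\<gamma> powr (- s) * exp (- \<gamma>))"
    using bound[of "of_real \<gamma>"] \<gamma>_pos by (simp add: sector_region_def mult.assoc)
  then have "0 \<le> C * (\<gamma> powr (- s) * exp (- \<gamma>))" using norm_ge_zero order_trans by blast
  moreover have "\<gamma> powr (- s) * exp (- \<gamma>) > 0" using \<gamma>_pos by simp
  ultimately show ?thesis by (simp only: zero_le_mult_iff not_le[symmetric]) auto
qed

lemma bound_at:
  assumes "p \<in> sector_region \<kappa> \<gamma>" "p \<notin> \<real>\<^sub>\<le>\<^sub>0" "0 < t" "t \<le> norm p"
  shows "norm (F p) \<le> C * t powr (- s) * exp (- t)"
proof -
  have "norm (F p) \<le> C * norm p powr (- s) * exp (- norm p)" using bound assms by blast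
  also have "\<dots> \<le> C * t powr (- s) * exp (- t)"
    using assms s C_nonneg by (intro mult_mono powr_mono2') auto
  finally show ?thesis .
qed

lemma continuous_F: "continuous_on (- \<real>\<^sub>\<le>\<^sub>0) F"
  using hol by (rule holomorphic_on_imp_continuous_on)

lemma continuous_line: "continuous_on UNIV (\<lambda>k. F (Complex \<gamma> k))"
  by (rule continuous_on_compose2[OF continuous_F])
    (use \<gamma>_pos in \<open>auto simp: Complex_eq complex_nonpos_Reals_iff intro!: continuous_intros\<close>)

lemma integrable_line: "integrable lborel (\<lambda>k. F (Complex \<gamma> k))"
proof (rule Bochner_Integration.integrable_bound)
  show "integrable lborel (\<lambda>k::real. C * \<gamma> powr (- s) * exp (- \<bar>k\<bar>))"
    using exp_minus_abs_integrable by simp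
  show "(\<lambda>k. F (Complex \<gamma> k)) \<in> borel_measurable lborel"
    using borel_measurable_continuous_onI[OF continuous_line] by simp
  show "AE k in lborel. norm (F (Complex \<gamma> k)) \<le> norm (C * \<gamma> powr (- s) * exp (- \<bar>k\<bar>))"
  proof (rule AE_I2)
    fix k :: real
    let ?p = "Complex \<gamma> k"
    have "\<kappa> * \<bar>k\<bar> \<le> 0" using \<kappa>_nonpos by (simp add: mult_nonpos_nonneg)
    then have "?p \<in> sector_region \<kappa> \<gamma>" using \<gamma>_pos by (simp add: sector_region_def)
    moreover have "?p \<notin> \<real>\<^sub>\<le>\<^sub>0" using \<gamma>_pos by (simp add: complex_nonpos_Reals_iff)
    ultimately have "norm (F ?p) \<le> C * norm ?p powr (- s) * exp (- norm ?p)" by (rule bound)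
    also have "\<dots> \<le> C * \<gamma> powr (- s) * exp (- \<bar>k\<bar>)"
      using abs_Re_le_cmod[of ?p] abs_Im_le_cmod[of ?p] \<gamma>_pos s C_nonneg
      by (intro mult_mono powr_mono2') auto
    finally show "norm (F ?p) \<le> norm (C * \<gamma> powr (- s) * exp (- \<bar>k\<bar>))"
      using C_nonneg by simp
  qed
qed

text \<open>The rays are parametrised by height rather than arc length: the point with parameter t
  has imaginary part t or -t. Truncated rays and the truncated vertical line therefore end at equal
  heights and can be joined by horizontal segments.\<close>

lemma ray_in_region:
  assumes "\<bar>v\<bar> = 1" "t > 0"
  shows "of_real t * Complex \<kappa> v \<in> sector_region \<kappa> \<gamma>" "of_real t * Complex \<kappa> v \<notin> \<real>\<^sub>\<le>\<^sub>0"
    "t \<le> norm (of_real t * Complex \<kappa> v)"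
proof -
  have "t * \<kappa> \<le> 0" using assms \<kappa>_nonpos by (simp add: mult_nonneg_nonpos)
  then show "of_real t * Complex \<kappa> v \<in> sector_region \<kappa> \<gamma>"
    using assms \<gamma>_pos by (simp add: sector_region_def abs_mult)
  show "of_real t * Complex \<kappa> v \<notin> \<real>\<^sub>\<le>\<^sub>0" using assms by (auto simp: complex_nonpos_Reals_iff)
  show "t \<le> norm (of_real t * Complex \<kappa> v)"
    using abs_Im_le_cmod[of "of_real t * Complex \<kappa> v"] assms by (simp add: abs_mult)
qed

lemma continuous_ray: "\<bar>v\<bar> = 1 \<Longrightarrow> continuous_on {0<..} (\<lambda>t. F (of_real t * Complex \<kappa> v))"
  by (rule continuous_on_compose2[OF continuous_F]) (auto intro!: continuous_intros dest: ray_in_region(2))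

lemma integrable_ray:
  assumes "\<bar>v\<bar> = 1"
  shows "set_integrable lborel {0<..} (\<lambda>t. F (of_real t * Complex \<kappa> v))"
  unfolding set_integrable_def
proof (rule Bochner_Integration.integrable_bound)
  show "integrable lborel (\<lambda>t. C * (indicator {0<..} t *\<^sub>R (t powr (- s) * exp (- t))))"
    using powr_exp_integrable[OF s(2)] unfolding set_integrable_def by (rule integrable_mult_right)
  show "(\<lambda>t. indicator {0<..} t *\<^sub>R F (of_real t * Complex \<kappa> v)) \<in> borel_measurable lborel"
    using borel_measurable_continuous_on_indicator[OF _ continuous_ray[OF assms]] by simp
  show "AE t in lborel. norm (indicator {0<..} t *\<^sub>R F (of_real t * Complex \<kappa> v))
      \<le> norm (C * (indicator {0<..} t *\<^sub>R (t powr (- s) * exp (- t))))"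
    using bound_at[OF ray_in_region(1,2) _ ray_in_region(3), OF assms _ assms _ _ assms] C_nonneg
    by (auto split: split_indicator simp: mult.assoc)
qed

text \<open>
  A primitive on the slit plane is compared at the ends of the contours along horizontal segments,
  where it barely changes; near the origin three sides of a small rectangle avoid the slit.
\<close>

proposition vertical_line_eq_rays:
  "\<i> * (\<integral>k. F (Complex \<gamma> k) \<partial>lborel) =
     Complex \<kappa> 1 * (\<integral>t\<in>{0<..}. F (of_real t * Complex \<kappa> 1) \<partial>lborel)
     - Complex \<kappa> (- 1) * (\<integral>t\<in>{0<..}. F (of_real t * Complex \<kappa> (- 1)) \<partial>lborel)"
proof -
  have "\<exists>\<Phi>. \<forall>p\<in>- \<real>\<^sub>\<le>\<^sub>0. (\<Phi> has_field_derivative F p) (at p)"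
    by (rule holomorphic_starlike_primitive[where k = "{}"])
      (use starlike_slit_plane continuous_F hol in \<open>auto simp: holomorphic_on_def
         at_within_open[of _ "- \<real>\<^sub>\<le>\<^sub>0"] open_Compl\<close>)
  then obtain \<Phi> where \<Phi>: "\<And>p. p \<notin> \<real>\<^sub>\<le>\<^sub>0 \<Longrightarrow> (\<Phi> has_field_derivative F p) (at p)" by auto
  \<comment> \<open>On a horizontal segment at height t every point has modulus at least |t|, so the
    derivative of \<Phi> is bounded there by its bound at |t|, and the mean value inequality applies
    on a convex set that misses the slit.\<close>
  have horizontal: "norm (\<Phi> (Complex x t) - \<Phi> (Complex y t)) \<le> C * \<bar>t\<bar> powr (- s) * exp (- \<bar>t\<bar>) * \<bar>x - y\<bar>"
    if "t \<noteq> 0" "\<kappa> * \<bar>t\<bar> \<le> x" "x \<le> \<gamma>" "\<kappa> * \<bar>t\<bar> \<le> y" "y \<le> \<gamma>" for x y t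
  proof -
    let ?S = "{p. Im p = t \<and> \<kappa> * \<bar>t\<bar> \<le> Re p \<and> Re p \<le> \<gamma>}"
    have "norm (\<Phi> (Complex x t) - \<Phi> (Complex y t))
        \<le> C * \<bar>t\<bar> powr (- s) * exp (- \<bar>t\<bar>) * norm (Complex x t - Complex y t)"
    proof (rule field_differentiable_bound[of ?S \<Phi> F])
      have "?S = {p. Im p \<ge> t} \<inter> {p. Im p \<le> t} \<inter> {p. Re p \<ge> \<kappa> * \<bar>t\<bar>} \<inter> {p. Re p \<le> \<gamma>}" by auto
      then show "convex ?S"
        by (simp add: convex_Int convex_halfspace_Re_ge convex_halfspace_Re_le
            convex_halfspace_Im_ge convex_halfspace_Im_le)
      fix p assume p: "p \<in> ?S"
      then have np: "p \<notin> \<real>\<^sub>\<le>\<^sub>0" using that by (auto simp: complex_nonpos_Reals_iff)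
      then show "(\<Phi> has_field_derivative F p) (at p within ?S)"
        using \<Phi> has_field_derivative_at_within by blast
      show "norm (F p) \<le> C * \<bar>t\<bar> powr (- s) * exp (- \<bar>t\<bar>)"
        using p np that abs_Im_le_cmod[of p] by (intro bound_at) (auto simp: sector_region_def)
    qed (use that in auto)
    then show ?thesis by (simp add: cmod_def)
  qed
  have vertical: "norm (\<Phi> (Complex e e) - \<Phi> (Complex e (- e))) \<le> C * e powr (- s) * exp (- e) * (2 * e)"
    if "0 < e" "e \<le> \<gamma>" for e
  proof -
    let ?S = "{p. Re p = e}"
    have "norm (\<Phi> (Complex e e) - \<Phi> (Complex e (- e)))
        \<le> C * e powr (- s) * exp (- e) * norm (Complex e e - Complex e (- e))"
    proof (rule field_differentiable_bound[of ?S \<Phi> F])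
      have "?S = {p. Re p \<ge> e} \<inter> {p. Re p \<le> e}" by auto
      then show "convex ?S" by (simp add: convex_Int convex_halfspace_Re_ge convex_halfspace_Re_le)
      fix p assume p: "p \<in> ?S"
      then have np: "p \<notin> \<real>\<^sub>\<le>\<^sub>0" using that by (auto simp: complex_nonpos_Reals_iff)
      then show "(\<Phi> has_field_derivative F p) (at p within ?S)"
        using \<Phi> has_field_derivative_at_within by blast
      have "\<kappa> * \<bar>Im p\<bar> \<le> 0" using \<kappa>_nonpos by (simp add: mult_nonpos_nonneg)
      then show "norm (F p) \<le> C * e powr (- s) * exp (- e)"
        using p np that abs_Re_le_cmod[of p] by (intro bound_at) (auto simp: sector_region_def)
    qed (use that in auto)
    moreover have "norm (Complex e e - Complex e (- e)) = 2 * e"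
      using that by (simp add: cmod_def real_sqrt_mult)
    ultimately show ?thesis by simp
  qed
  let ?w = "\<lambda>v. Complex \<kappa> v"
  \<comment> \<open>The truncated line minus the two truncated rays. Each summand is a difference of
    values of \<Phi>, so only the end points matter.\<close>
  define D where "D n = (\<Phi> (Complex \<gamma> (Suc n)) - \<Phi> (Complex \<gamma> (- real (Suc n))))
    - (\<Phi> (of_real (Suc n) * ?w 1) - \<Phi> (of_real (1 / Suc n) * ?w 1))
    + (\<Phi> (of_real (Suc n) * ?w (- 1)) - \<Phi> (of_real (1 / Suc n) * ?w (- 1)))" for n
  have lim: "D \<longlonglongrightarrow> \<i> * (\<integral>k. F (Complex \<gamma> k) \<partial>lborel)
      - ?w 1 * (\<integral>t\<in>{0<..}. F (of_real t * ?w 1) \<partial>lborel)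
      + ?w (- 1) * (\<integral>t\<in>{0<..}. F (of_real t * ?w (- 1)) \<partial>lborel)"
    unfolding D_def
  proof (intro tendsto_add tendsto_diff ray_FTC integrable_ray continuous_ray \<Phi> ray_in_region)
    show "(\<lambda>n. \<Phi> (Complex \<gamma> (Suc n)) - \<Phi> (Complex \<gamma> (- real (Suc n))))
        \<longlonglongrightarrow> \<i> * (\<integral>k. F (Complex \<gamma> k) \<partial>lborel)"
      by (rule LIMSEQ_Suc[OF vertical_line_FTC])
        (use \<gamma>_pos in \<open>auto intro!: \<Phi> continuous_line integrable_line simp: complex_nonpos_Reals_iff\<close>)
  qed auto
  \<comment> \<open>The first summand bounds the two horizontal segments at heights N and -N, of
    length \<gamma> - \<kappa> N. The second bounds the detour around the origin: its three sides
    have total length (4 - 2 \<kappa>) / N, and F is of order N^s on them.\<close>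
  define b where "b N = 2 * C * (exp (- N) * (\<gamma> - \<kappa> * N)) + C * (4 - 2 * \<kappa>) * N powr (s - 1)" for N :: real
  have "D \<longlonglongrightarrow> 0"
  proof (rule Lim_null_comparison)
    have "(b \<longlongrightarrow> 2 * C * 0 + C * (4 - 2 * \<kappa>) * 0) at_top"
      unfolding b_def
    proof (intro tendsto_intros)
      show "((\<lambda>N. exp (- N) * (\<gamma> - \<kappa> * N)) \<longlongrightarrow> 0) at_top" by real_asymp
      show "((\<lambda>N. N powr (s - 1)) \<longlongrightarrow> 0) at_top"
        using s by (intro tendsto_neg_powr filterlim_ident) auto
    qed
    then have "(b \<longlongrightarrow> 0) at_top" by simp
    moreover have "filterlim (\<lambda>n. real (Suc n)) at_top sequentially" by real_asymp
    ultimately show "(\<lambda>n. b (real (Suc n))) \<longlonglongrightarrow> 0" by (rule filterlim_compose)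
    \<comment> \<open>The detour passes through the corners e + i e and e - i e, which must not lie
      to the right of Re p = \<gamma>.\<close>
    have "\<forall>\<^sub>F n in sequentially. 1 / real (Suc n) \<le> \<gamma>"
    proof -
      obtain N where N: "1 / \<gamma> \<le> real N" using real_arch_simple by blast
      show ?thesis
      proof (rule eventually_sequentiallyI[of N])
        fix n assume "N \<le> n"
        then have "1 / \<gamma> \<le> real (Suc n)" using N by linarith
        then show "1 / real (Suc n) \<le> \<gamma>" using \<gamma>_pos by (simp add: field_simps)
      qed
    qed
    then show "\<forall>\<^sub>F n in sequentially. norm (D n) \<le> b (real (Suc n))"
    proof eventually_elim
      case (elim n)
      define N e where "N = real (Suc n)" and "e = 1 / N"
      have N: "N \<ge> 1" by (simp add: N_def)
      have e: "0 < e" "e \<le> \<gamma>" using elim by (auto simp: N_def e_def)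
      have \<kappa>N: "\<kappa> * N \<le> 0" and \<kappa>e: "\<kappa> * e \<le> 0" using \<kappa>_nonpos N e by (auto simp: mult_nonpos_nonneg)
      have pt: "of_real t * ?w v = Complex (\<kappa> * t) (v * t)" for t v
        by (simp add: complex_eq_iff)
      \<comment> \<open>Regrouped along the joining segments. The last three brackets lead from one
        ray's starting point to the other's, passing the origin on the right, where there is no
        slit.\<close>
      have D: "D n = (\<Phi> (Complex \<gamma> N) - \<Phi> (Complex (\<kappa> * N) N))
        - (\<Phi> (Complex \<gamma> (- N)) - \<Phi> (Complex (\<kappa> * N) (- N)))
        + (\<Phi> (Complex (\<kappa> * e) e) - \<Phi> (Complex e e))
        + (\<Phi> (Complex e e) - \<Phi> (Complex e (- e)))
        + (\<Phi> (Complex e (- e)) - \<Phi> (Complex (\<kappa> * e) (- e)))"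
        unfolding D_def N_def[symmetric] e_def[symmetric] pt by simp
      define h where "h t = C * t powr (- s) * exp (- t)" for t
      have n1: "norm (\<Phi> (Complex \<gamma> N) - \<Phi> (Complex (\<kappa> * N) N)) \<le> h N * (\<gamma> - \<kappa> * N)"
        using horizontal[of N \<gamma> "\<kappa> * N"] N \<kappa>N \<gamma>_pos by (simp add: h_def)
      have n2: "norm (\<Phi> (Complex \<gamma> (- N)) - \<Phi> (Complex (\<kappa> * N) (- N))) \<le> h N * (\<gamma> - \<kappa> * N)"
        using horizontal[of "- N" \<gamma> "\<kappa> * N"] N \<kappa>N \<gamma>_pos by (simp add: h_def)
      have n3: "norm (\<Phi> (Complex (\<kappa> * e) e) - \<Phi> (Complex e e)) \<le> h e * (e - \<kappa> * e)"
        using horizontal[of e "\<kappa> * e" e] e \<kappa>e \<kappa>_nonpos by (simp add: h_def)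
      have n4: "norm (\<Phi> (Complex e e) - \<Phi> (Complex e (- e))) \<le> h e * (2 * e)"
        using vertical[of e] e by (simp add: h_def)
      have n5: "norm (\<Phi> (Complex e (- e)) - \<Phi> (Complex (\<kappa> * e) (- e))) \<le> h e * (e - \<kappa> * e)"
        using horizontal[of "- e" e "\<kappa> * e"] e \<kappa>e \<kappa>_nonpos by (simp add: h_def)
      have "norm (D n) \<le> h N * (\<gamma> - \<kappa> * N) + h N * (\<gamma> - \<kappa> * N) + h e * (e - \<kappa> * e) + h e * (2 * e) + h e * (e - \<kappa> * e)"
        unfolding D by (intro norm_triangle_le norm_triangle_le_diff add_mono n1 n2 n3 n4 n5)
      also have "\<dots> = 2 * (h N * (\<gamma> - \<kappa> * N)) + (4 - 2 * \<kappa>) * (h e * e)" by (simp add: algebra_simps)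
      also have "\<dots> \<le> b N"
      proof -
        have "N powr (- s) \<le> 1" using N s powr_mono[of "- s" 0 N] by simp
        then have "h N \<le> C * exp (- N)" unfolding h_def using C_nonneg by (simp add: mult_left_le mult_right_mono)
        then have "h N * (\<gamma> - \<kappa> * N) \<le> C * exp (- N) * (\<gamma> - \<kappa> * N)"
          using \<kappa>N \<gamma>_pos by (intro mult_right_mono) auto
        moreover have "h e * e \<le> C * N powr (s - 1)"
        proof -
          have "h e * e \<le> C * e powr (- s) * 1 * e"
            unfolding h_def using C_nonneg e by (intro mult_right_mono mult_left_mono) auto
          also have "\<dots> = C * (e powr (- s) * e powr 1)" using e by simp
          also have "\<dots> = C * N powr (s - 1)"
            unfolding powr_add[symmetric] using N by (simp add: e_def powr_divide powr_minus[symmetric] flip: powr_minus_divide)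
          finally show ?thesis .
        qed
        then have "(4 - 2 * \<kappa>) * (h e * e) \<le> (4 - 2 * \<kappa>) * (C * N powr (s - 1))"
          using \<kappa>_nonpos by (intro mult_left_mono) auto
        ultimately show ?thesis unfolding b_def by (simp add: algebra_simps)
      qed
      finally show ?case by (simp add: N_def)
    qed
  qed
  from LIMSEQ_unique[OF lim this] show ?thesis by (simp add: algebra_simps)
qed

end

subsection \<open>The Hankel-type integrals\<close>

lemma powr_le_exp: "r > 0 \<Longrightarrow> a \<ge> 0 \<Longrightarrow> r powr a \<le> exp (a * r)" for r a :: real
  by (auto simp: powr_def intro!: mult_left_mono less_imp_le[OF ln_less_self])

locale stable_line =
  fixes c \<alpha> \<gamma> :: real
  assumes c: "c > 0" and \<alpha>: "1 < \<alpha>" "\<alpha> \<le> 2" and \<gamma>: "\<gamma> > 0"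
begin

text \<open>The decay rate of the transform is arbitrary, so rate A + 1 swallows growth e^(A |p|)
  and leaves e^(-|p|). A larger \<kappa> only shrinks the region; hence the same bound serves the
  imaginary axis (\<kappa> = 0) and the rays of argument pi/\<alpha> and -pi/\<alpha>.\<close>

lemma sector_contour_stable:
  assumes hol: "G holomorphic_on (- \<real>\<^sub>\<le>\<^sub>0)" and s: "0 \<le> s" "s < 1"
    and \<kappa>: "sector_slope \<alpha> \<le> \<kappa>" "\<kappa> \<le> 0"
    and G: "\<And>p. p \<in> sector_region \<kappa> \<gamma> \<Longrightarrow> p \<notin> \<real>\<^sub>\<le>\<^sub>0 \<Longrightarrow> norm (G p) \<le> B * norm p powr (- s) * exp (A * norm p)"
  obtains C where "sector_contour (\<lambda>p. stable_mgf c \<alpha> p * G p) \<gamma> \<kappa> s C"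
proof -
  obtain C where C: "C > 0" "\<And>p. p \<in> sector_region (sector_slope \<alpha>) \<gamma> \<Longrightarrow>
      norm (stable_mgf c \<alpha> p) \<le> C * exp (- (A + 1) * norm p)"
    using stable_mgf_bound[OF c \<alpha> \<gamma>, of "A + 1"] by blast
  have "sector_contour (\<lambda>p. stable_mgf c \<alpha> p * G p) \<gamma> \<kappa> s (C * B)"
  proof
    show "(\<lambda>p. stable_mgf c \<alpha> p * G p) holomorphic_on (- \<real>\<^sub>\<le>\<^sub>0)"
      using hol by (intro holomorphic_intros)
    fix p assume p: "p \<in> sector_region \<kappa> \<gamma>" "p \<notin> \<real>\<^sub>\<le>\<^sub>0"
    have "p \<in> sector_region (sector_slope \<alpha>) \<gamma>"
      using p \<kappa> mult_right_mono[OF \<kappa>(1), of "\<bar>Im p\<bar>"] by (auto simp: sector_region_def)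
    then have "norm (stable_mgf c \<alpha> p * G p)
        \<le> (C * exp (- (A + 1) * norm p)) * (B * norm p powr (- s) * exp (A * norm p))"
      unfolding norm_mult using C p by (intro mult_mono G) auto
    also have "\<dots> = C * B * norm p powr (- s) * exp (- (A + 1) * norm p + A * norm p)"
      unfolding exp_add by (simp add: mult_ac)
    also have "- (A + 1) * norm p + A * norm p = - norm p" by (simp add: algebra_simps)
    finally show "norm (stable_mgf c \<alpha> p * G p) \<le> C * B * norm p powr (- s) * exp (- norm p)" .
  qed (use \<gamma> \<kappa> s in auto)
  then show thesis by (rule that)
qed

lemma line_not_nonpos_Reals [simp]: "Complex \<gamma> k \<notin> \<real>\<^sub>\<le>\<^sub>0"
  using \<gamma> by (simp add: complex_nonpos_Reals_iff)

lemma line_nonzero [simp]: "Complex \<gamma> k \<noteq> 0"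
  using \<gamma> by (simp add: complex_eq_iff)

lemma \<gamma>_le_norm_line: "\<gamma> \<le> norm (Complex \<gamma> k)" "\<bar>k\<bar> \<le> norm (Complex \<gamma> k)"
  using abs_Re_le_cmod[of "Complex \<gamma> k"] abs_Im_le_cmod[of "Complex \<gamma> k"] by simp_all

lemma line_in_region: "Complex \<gamma> k \<in> sector_region (sector_slope \<alpha>) \<gamma>"
proof -
  have "sector_slope \<alpha> * \<bar>k\<bar> \<le> 0" using sector_slope(1)[OF \<alpha>] by (simp add: mult_nonpos_nonneg)
  then show ?thesis using \<gamma> by (simp add: sector_region_def)
qed

lemma continuous_on_Complex_line: "continuous_on A (Complex \<gamma>)"
  unfolding Complex_eq[abs_def] by (intro continuous_intros)

lemma continuous_on_stable_line:
  "continuous_on UNIV (\<lambda>k. stable_mgf c \<alpha> (Complex \<gamma> k))"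
  by (rule continuous_on_compose2[OF holomorphic_on_imp_continuous_on[OF holomorphic_stable_mgf[of c \<alpha>]]])
    (auto intro: continuous_on_Complex_line)

lemma stable_line_bound:
  obtains C where "C > 0" "\<And>k. norm (stable_mgf c \<alpha> (Complex \<gamma> k)) \<le> C * exp (- A * norm (Complex \<gamma> k))"
proof (rule stable_mgf_bound[OF c \<alpha> \<gamma>, of A])
  fix C assume "C > 0" "\<And>p. p \<in> sector_region (sector_slope \<alpha>) \<gamma> \<Longrightarrow>
      norm (stable_mgf c \<alpha> p) \<le> C * exp (- A * norm p)"
  then show thesis using that[of C] line_in_region by simp
qed

lemma stable_line_mult_bound:
  assumes G: "\<And>k. norm (G k) \<le> B * exp (A * norm (Complex \<gamma> k))"
  shows "\<exists>C\<ge>0. \<forall>k. norm (stable_mgf c \<alpha> (Complex \<gamma> k) * G k) \<le> C * exp (- \<bar>k\<bar>)"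
proof -
  obtain C where C: "C > 0" "\<And>k. norm (stable_mgf c \<alpha> (Complex \<gamma> k)) \<le> C * exp (- (A + 1) * norm (Complex \<gamma> k))"
    using stable_line_bound[of "A + 1"] by blast
  have "B * exp (A * norm (Complex \<gamma> 0)) \<ge> 0" using G[of 0] norm_ge_zero order_trans by blast
  then have B: "B \<ge> 0" by (simp add: zero_le_mult_iff)
  have "norm (stable_mgf c \<alpha> (Complex \<gamma> k) * G k) \<le> C * B * exp (- \<bar>k\<bar>)" for k
  proof -
    have "norm (stable_mgf c \<alpha> (Complex \<gamma> k) * G k)
        \<le> (C * exp (- (A + 1) * norm (Complex \<gamma> k))) * (B * exp (A * norm (Complex \<gamma> k)))"
      unfolding norm_mult using C by (intro mult_mono G) auto
    also have "\<dots> = C * B * exp (- (A + 1) * norm (Complex \<gamma> k) + A * norm (Complex \<gamma> k))"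
      unfolding exp_add by (simp add: mult_ac)
    also have "- (A + 1) * norm (Complex \<gamma> k) + A * norm (Complex \<gamma> k) = - norm (Complex \<gamma> k)"
      by (simp add: algebra_simps)
    also have "C * B * exp (- norm (Complex \<gamma> k)) \<le> C * B * exp (- \<bar>k\<bar>)"
      using C B \<gamma>_le_norm_line[of k] by (intro mult_left_mono) auto
    finally show ?thesis .
  qed
  then show ?thesis using C B by (intro exI[of _ "C * B"]) auto
qed

lemma stable_line_integrable:
  assumes "G \<in> borel_measurable borel"
    and "\<And>k. norm (G k) \<le> B * exp (A * norm (Complex \<gamma> k))"
  shows "integrable lborel (\<lambda>k. stable_mgf c \<alpha> (Complex \<gamma> k) * G k)"
proof -
  obtain C where C: "C \<ge> 0" "\<And>k. norm (stable_mgf c \<alpha> (Complex \<gamma> k) * G k) \<le> C * exp (- \<bar>k\<bar>)"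
    using stable_line_mult_bound[OF assms(2)] by auto
  show ?thesis
  proof (rule Bochner_Integration.integrable_bound)
    show "integrable lborel (\<lambda>k::real. C * exp (- \<bar>k\<bar>))" using exp_minus_abs_integrable by simp
    show "(\<lambda>k. stable_mgf c \<alpha> (Complex \<gamma> k) * G k) \<in> borel_measurable lborel"
      using borel_measurable_continuous_onI[OF continuous_on_stable_line] assms(1) by simp
    show "AE k in lborel. norm (stable_mgf c \<alpha> (Complex \<gamma> k) * G k) \<le> norm (C * exp (- \<bar>k\<bar>))"
      using C by (intro AE_I2) (metis abs_ge_self order_trans real_norm_def)
  qed
qed

lemma norm_powr_line: "norm (Complex \<gamma> k powr of_real s) = norm (Complex \<gamma> k) powr s"
  by (simp add: norm_powr_complex)

text \<open>Positive powers grow more slowly than an exponential; negative ones are bounded because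
  |p| \<ge> \<gamma> on the line. One bound for both signs suffices, since exponential growth is
  harmless here.\<close>

lemma powr_line_bound: "norm (Complex \<gamma> k powr of_real s) \<le> max 1 (\<gamma> powr s) * exp (\<bar>s\<bar> * norm (Complex \<gamma> k))"
proof (cases "s \<ge> 0")
  case True
  have "norm (Complex \<gamma> k) powr s \<le> 1 * exp (s * norm (Complex \<gamma> k))"
    using True powr_le_exp[of "norm (Complex \<gamma> k)" s] by simp
  also have "\<dots> \<le> max 1 (\<gamma> powr s) * exp (s * norm (Complex \<gamma> k))" by (intro mult_right_mono) auto
  finally show ?thesis using True unfolding norm_powr_line by simp
next
  case False
  have "norm (Complex \<gamma> k) powr s \<le> \<gamma> powr s * 1"
    using False \<gamma> \<gamma>_le_norm_line[of k] powr_mono2'[of s \<gamma> "norm (Complex \<gamma> k)"] by simp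
  also have "\<dots> \<le> max 1 (\<gamma> powr s) * exp (\<bar>s\<bar> * norm (Complex \<gamma> k))"
    by (intro mult_mono) auto
  finally show ?thesis unfolding norm_powr_line .
qed

lemma measurable_Complex [measurable]: "(\<lambda>k. Complex \<gamma> k) \<in> borel_measurable borel"
  unfolding Complex_eq by measurable

lemma powr_line_continuous: "continuous_on UNIV (\<lambda>k. Complex \<gamma> k powr of_real s)"
proof -
  have "(\<lambda>p. p powr of_real s) holomorphic_on (- \<real>\<^sub>\<le>\<^sub>0)" by (intro holomorphic_intros) auto
  then show ?thesis
    by (rule continuous_on_compose2[OF holomorphic_on_imp_continuous_on])
       (auto intro: continuous_on_Complex_line)
qed

text \<open>With dp = i dk this is 2 pi times the contour integral of e^(c p^\<alpha>) p^(-s) / (2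
  pi i). On the line there is no singularity, so every real s is allowed.\<close>

definition hankel :: "real \<Rightarrow> complex" where
  "hankel s = (\<integral>k. stable_mgf c \<alpha> (Complex \<gamma> k) * Complex \<gamma> k powr of_real (- s) \<partial>lborel)"

lemma hankel_integrable:
  "integrable lborel (\<lambda>k. stable_mgf c \<alpha> (Complex \<gamma> k) * Complex \<gamma> k powr of_real (- s))"
  by (rule stable_line_integrable[OF _ powr_line_bound])
     (use borel_measurable_continuous_onI[OF powr_line_continuous] in simp)

text \<open>Integration by parts: the integrand F is the derivative of e^(c p^\<alpha>) p^(-s),
  whose boundary values at both ends of the line vanish.\<close>

lemma hankel_recurrence: "of_real s * hankel (s + 1) = of_real (c * \<alpha>) * hankel (s + 1 - \<alpha>)"
proof -
  define \<Phi> where "\<Phi> p = stable_mgf c \<alpha> p * p powr of_real (- s)" for p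
  define F where "F p = of_real (c * \<alpha>) * (stable_mgf c \<alpha> p * p powr of_real (- (s + 1 - \<alpha>)))
     - of_real s * (stable_mgf c \<alpha> p * p powr of_real (- (s + 1)))" for p
  have deriv: "(\<Phi> has_field_derivative F (Complex \<gamma> k)) (at (Complex \<gamma> k))" for k
  proof -
    let ?p = "Complex \<gamma> k"
    have 1: "?p powr (of_real \<alpha> - 1) * ?p powr of_real (- s) = ?p powr of_real (- (s + 1 - \<alpha>))"
      by (simp flip: powr_add add: algebra_simps)
    have 2: "of_real (- s) - 1 = (of_real (- (s + 1)) :: complex)" by simp
    have "((\<lambda>p. stable_mgf c \<alpha> p * p powr of_real (- s)) has_field_derivative
        stable_mgf c \<alpha> ?p * (of_real c * (of_real \<alpha> * ?p powr (of_real \<alpha> - 1))) * ?p powr of_real (- s)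
        + (of_real (- s) * ?p powr (of_real (- s) - 1)) * stable_mgf c \<alpha> ?p) (at ?p)"
      unfolding stable_mgf_def
      by (rule derivative_eq_intros has_field_derivative_powr refl line_not_nonpos_Reals)+ simp
    moreover have "stable_mgf c \<alpha> ?p * (of_real c * (of_real \<alpha> * ?p powr (of_real \<alpha> - 1))) * ?p powr of_real (- s)
        + (of_real (- s) * ?p powr (of_real (- s) - 1)) * stable_mgf c \<alpha> ?p = F ?p"
      unfolding F_def 1[symmetric] 2 by (simp add: algebra_simps)
    ultimately show ?thesis unfolding \<Phi>_def by simp
  qed
  have int: "integrable lborel (\<lambda>k. F (Complex \<gamma> k))"
    unfolding F_def by (intro Bochner_Integration.integrable_diff integrable_mult_right hankel_integrable)
  have F: "(\<integral>k. F (Complex \<gamma> k) \<partial>lborel) = of_real (c * \<alpha>) * hankel (s + 1 - \<alpha>) - of_real s * hankel (s + 1)"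
    unfolding F_def hankel_def
    by (simp only: Bochner_Integration.integral_diff integrable_mult_right hankel_integrable
        integral_mult_right_zero)
  have lim: "(\<lambda>n. \<Phi> (Complex \<gamma> (real n)) - \<Phi> (Complex \<gamma> (- real n))) \<longlonglongrightarrow> \<i> * (\<integral>k. F (Complex \<gamma> k) \<partial>lborel)"
  proof (rule vertical_line_FTC[OF deriv _ int])
    show "continuous_on UNIV (\<lambda>k. F (Complex \<gamma> k))"
      unfolding F_def by (intro continuous_intros continuous_on_stable_line powr_line_continuous)
  qed
  moreover have "(\<lambda>n. \<Phi> (Complex \<gamma> (real n)) - \<Phi> (Complex \<gamma> (- real n))) \<longlonglongrightarrow> 0 - 0"
  proof (rule tendsto_diff)
    obtain C where le: "\<And>k. norm (\<Phi> (Complex \<gamma> k)) \<le> C * exp (- \<bar>k\<bar>)"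
      using stable_line_mult_bound[OF powr_line_bound[of _ "- s"]] unfolding \<Phi>_def by auto
    have lim: "(\<lambda>n. C * exp (- real n)) \<longlonglongrightarrow> 0" by real_asymp
    show "(\<lambda>n. \<Phi> (Complex \<gamma> (real n))) \<longlonglongrightarrow> 0"
      by (rule Lim_null_comparison[OF _ lim]) (use le[of "real _"] in auto)
    show "(\<lambda>n. \<Phi> (Complex \<gamma> (- real n))) \<longlonglongrightarrow> 0"
      by (rule Lim_null_comparison[OF _ lim]) (use le[of "- real _"] in auto)
  qed
  ultimately have "\<i> * (\<integral>k. F (Complex \<gamma> k) \<partial>lborel) = 0"
    using LIMSEQ_unique[OF lim] by simp
  then show ?thesis unfolding F by simp
qed

end

section \<open>Evaluation by the reciprocal Gamma function\<close>

lemma Gamma_set_integral: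
  assumes "z > (0::real)"
  shows "(\<integral>t\<in>{0<..}. t powr (z - 1) * exp (- t) \<partial>lborel) = Gamma z"
  using integral_unique[OF Gamma_integral_real_Ioi[OF assms]] powr_exp_integrable[of "1 - z"] assms
  by (simp add: set_borel_integral_eq_integral(2))

text \<open>The substitution t = c q^\<alpha> turns the stretched exponential into a Gamma
  integral.\<close>

lemma powr_stretched_exp_integral:
  fixes c \<alpha> s :: real
  assumes "c > 0" "\<alpha> > 0" "s < 1"
  shows "(\<integral>q\<in>{0<..}. exp (- c * q powr \<alpha>) * q powr (- s) \<partial>lborel)
           = 1 / \<alpha> * c powr (- ((1 - s) / \<alpha>)) * Gamma ((1 - s) / \<alpha>)"
proof -
  define z where "z = (1 - s) / \<alpha>"
  have z: "z > 0" using assms by (simp add: z_def)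
  define f where "f q = exp (- c * q powr \<alpha>) * q powr (- s)" for q
  \<comment> \<open>The inverse of q \<mapsto> c q^\<alpha>; \<open>g'\<close> is its
    derivative.\<close>
  define g where "g t = (t / c) powr (1 / \<alpha>)" for t
  define g' where "g' t = 1 / \<alpha> * (t / c) powr (1 / \<alpha> - 1) / c" for t
  have fg: "f (g t) * g' t = 1 / \<alpha> * c powr (- z) * (t powr (z - 1) * exp (- t))" if "t > 0" for t
  proof -
    have "f (g t) * g' t = exp (- t) * ((t / c) powr (- s / \<alpha>) * (t / c) powr (1 / \<alpha> - 1)) * (1 / \<alpha> / c)"
      using assms that by (simp add: f_def g_def g'_def powr_powr)
    also have "(t / c) powr (- s / \<alpha>) * (t / c) powr (1 / \<alpha> - 1) = (t / c) powr (z - 1)"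
      using that assms by (simp flip: powr_add add: z_def diff_divide_distrib algebra_simps)
    also have "\<dots> = t powr (z - 1) * c powr (- z) * c"
    proof -
      have "c powr (z - 1) = c powr z / c" using assms by (simp add: powr_diff)
      moreover have "c powr (- z) = 1 / c powr z" by (rule powr_minus_divide)
      ultimately show ?thesis using that assms by (simp add: powr_divide)
    qed
    finally show ?thesis using assms by simp
  qed
  have pos: "einterval 0 \<infinity> = {0<..}" by (auto simp: einterval_def)
  have "(LBINT x=0..\<infinity>. f x) = (LBINT x=0..\<infinity>. f (g x) * g' x)"
  proof (rule interval_integral_substitution_nonneg(2))
    fix x :: real assume "0 < ereal x" "ereal x < \<infinity>"
    then have x: "x > 0" by simp
    have "((\<lambda>t. (t / c) powr (1 / \<alpha>)) has_real_derivative
        1 / \<alpha> * (x / c) powr (1 / \<alpha> - 1) * (1 / c)) (at x)"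
      by (rule DERIV_chain2[OF has_real_derivative_powr])
        (use x assms in \<open>auto intro!: derivative_eq_intros\<close>)
    then show "(g has_real_derivative g' x) (at x)"
      by (simp add: g_def[abs_def] g'_def)
    show "isCont f (g x)" unfolding f_def[abs_def] using x assms by (intro continuous_intros) (auto simp: g_def)
    show "isCont g' x" unfolding g'_def[abs_def] using x assms by (intro continuous_intros) auto
    show "0 \<le> f (g x)" by (simp add: f_def)
  next
    fix x show "0 \<le> g' x" using assms by (simp add: g'_def)
  next
    have "(g \<longlongrightarrow> 0) (at_right 0)"
      unfolding g_def[abs_def]
    proof (rule tendsto_zero_powrI[where b = "1 / \<alpha>"])
      have "((\<lambda>t. t / c) \<longlongrightarrow> 0 / c) (at_right 0)" using assms by (intro tendsto_intros) auto
      then show "((\<lambda>t. t / c) \<longlongrightarrow> 0) (at_right 0)" by simp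
      show "\<forall>\<^sub>F t in at_right 0. 0 \<le> t / c"
        using assms by (auto simp: eventually_at_filter)
    qed (use assms in auto)
    then show "((ereal \<circ> g \<circ> real_of_ereal) \<longlongrightarrow> 0) (at_right 0)"
      unfolding zero_ereal_def by (simp only: ereal_tendsto_simps)
    have "filterlim g at_top at_top"
      unfolding filterlim_at_top
    proof
      fix Z :: real
      show "\<forall>\<^sub>F t in at_top. Z \<le> g t"
      proof (rule eventually_at_top_linorderI)
        fix t assume t: "c * \<bar>Z\<bar> powr \<alpha> \<le> t"
        have "Z \<le> (\<bar>Z\<bar> powr \<alpha>) powr (1 / \<alpha>)" using assms by (simp add: powr_powr)
        also have "\<dots> \<le> g t"
          unfolding g_def using t assms by (intro powr_mono2) (auto simp: field_simps)
        finally show "Z \<le> g t" .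
      qed
    qed
    then show "((ereal \<circ> g \<circ> real_of_ereal) \<longlongrightarrow> \<infinity>) (at_left \<infinity>)"
      by (simp only: ereal_tendsto_simps)
  next
    have "set_integrable lborel {0<..} (\<lambda>t. 1 / \<alpha> * c powr (- z) * (t powr (z - 1) * exp (- t)))"
      using powr_exp_integrable[of "1 - z"] z by (intro set_integrable_mult_right) simp
    then show "set_integrable lborel (einterval 0 \<infinity>) (\<lambda>x. f (g x) * g' x)"
      by (rule set_integrable_cong[THEN iffD1, rotated 3]) (auto simp: einterval_def fg)
  qed simp
  also have "\<dots> = (\<integral>t\<in>{0<..}. 1 / \<alpha> * c powr (- z) * (t powr (z - 1) * exp (- t)) \<partial>lborel)"
    unfolding interval_lebesgue_integral_def pos
    by (subst if_P, simp, intro set_lebesgue_integral_cong) (auto simp: fg)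
  also have "\<dots> = 1 / \<alpha> * c powr (- z) * Gamma z"
    using Gamma_set_integral[OF z] by simp
  finally show ?thesis
    by (simp add: interval_lebesgue_integral_def pos z_def f_def)
qed

lemma rGamma_reflection_real: "rGamma z * rGamma (1 - z) = sin (pi * z) / pi" for z :: real
proof -
  have "complex_of_real (rGamma z * rGamma (1 - z)) = rGamma (of_real z) * rGamma (1 - of_real z)"
    unfolding of_real_mult rGamma_complex_of_real[symmetric] by simp
  also have "\<dots> = of_real (sin (pi * z) / pi)"
    unfolding rGamma_reflection_complex by (simp only: of_real_mult[symmetric] sin_of_real of_real_divide)
  finally have "complex_of_real (rGamma z * rGamma (1 - z)) = of_real (sin (pi * z) / pi)" .
  then show ?thesis by (simp only: of_real_eq_iff)
qed

context stable_line
begin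

text \<open>On the rays of argument pi/\<alpha> and -pi/\<alpha> the number p^\<alpha> is
  -|p|^\<alpha>, so both ray integrals are the same real integral times conjugate phases. Their
  difference yields sin((1 - s) pi/\<alpha>) times a Gamma value, which the reflection formula
  converts into a reciprocal Gamma value.\<close>

lemma hankel_less_1:
  assumes s: "s < 1"
  shows "hankel s = of_real (2 * pi / \<alpha> * c powr ((s - 1) / \<alpha>) * rGamma (1 + (s - 1) / \<alpha>))"
proof -
  define \<kappa> \<theta> where "\<kappa> = sector_slope \<alpha>" and "\<theta> = pi / \<alpha>"
  have \<kappa>: "\<kappa> \<le> 0" "pi / 2 - arctan \<kappa> = \<theta>" using sector_slope[OF \<alpha>] by (auto simp: \<kappa>_def \<theta>_def)
  \<comment> \<open>The singularity exponent of the contour must be nonnegative. For s < 0 the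
    factor |p|^(-s) is not singular but growing, and it goes into the exponential with rate
    -s.\<close>
  obtain C where "sector_contour (\<lambda>p. stable_mgf c \<alpha> p * p powr of_real (- s)) \<gamma> \<kappa> (max 0 s) C"
  proof (rule sector_contour_stable)
    show "(\<lambda>p. p powr of_real (- s)) holomorphic_on (- \<real>\<^sub>\<le>\<^sub>0)" by (intro holomorphic_intros) auto
    fix p :: complex assume "p \<notin> \<real>\<^sub>\<le>\<^sub>0"
    then have p: "norm p > 0" by auto
    have "norm p powr (- s) \<le> 1 * norm p powr (- max 0 s) * exp (max 0 (- s) * norm p)"
    proof (cases "s \<ge> 0")
      case False
      then show ?thesis using powr_le_exp[OF p, of "- s"] p by (simp add: max_def)
    qed (simp add: max_def)
    then show "norm (p powr of_real (- s)) \<le> 1 * norm p powr (- max 0 s) * exp (max 0 (- s) * norm p)"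
      by (simp add: norm_powr_complex)
  qed (use s \<kappa> in \<open>auto simp: \<kappa>_def\<close>)
  then interpret sc: sector_contour "\<lambda>p. stable_mgf c \<alpha> p * p powr of_real (- s)" \<gamma> \<kappa> "max 0 s" C .
  \<comment> \<open>The parameter of a ray is its height, so the modulus of the point with parameter
    t is l t; the rescaling q = l t later removes this factor.\<close>
  define l where "l = norm (Complex \<kappa> 1)"
  have l: "l > 0" by (simp add: l_def complex_eq_iff)
  have ln1: "Ln (of_real t * Complex \<kappa> 1) = of_real (ln (l * t)) + \<i> * of_real \<theta>" if "t > 0" for t
  proof -
    have "Arg (of_real t * Complex \<kappa> 1) = \<theta>"
      using that \<kappa> by (subst Arg_upper_half_plane) auto
    moreover have "of_real t * Complex \<kappa> 1 \<noteq> 0" using that by (simp add: complex_eq_iff)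
    moreover have "norm (of_real t * Complex \<kappa> 1) = l * t" using that by (simp add: norm_mult l_def)
    ultimately show ?thesis by (simp add: Ln_Arg)
  qed
  have ln2: "Ln (of_real t * Complex \<kappa> v) = of_real (ln (l * t)) + \<i> * of_real (v * \<theta>)"
    if "t > 0" "v = 1 \<or> v = - 1" for t v
    using that(2)
  proof
    assume v: "v = - 1"
    have "of_real t * Complex \<kappa> v = cnj (of_real t * Complex \<kappa> 1)" by (simp add: v complex_eq_iff)
    also have "Ln \<dots> = cnj (Ln (of_real t * Complex \<kappa> 1))"
      using that by (intro cnj_Ln[symmetric] sc.ray_in_region) auto
    finally show ?thesis using ln1[OF that(1)] v by simp
  qed (use ln1[OF that(1)] in simp)
  have powr: "(of_real t * Complex \<kappa> v) powr of_real a = of_real ((l * t) powr a) * cis (a * (v * \<theta>))"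
    if "t > 0" "v = 1 \<or> v = - 1" for t v a
  proof -
    have "of_real t * Complex \<kappa> v \<noteq> 0" using that by (auto simp: complex_eq_iff)
    then have "(of_real t * Complex \<kappa> v) powr of_real a
        = exp (of_real a * (of_real (ln (l * t)) + \<i> * of_real (v * \<theta>)))"
      using ln2[OF that] by (simp only: powr_def if_False)
    also have "\<dots> = exp (of_real (a * ln (l * t))) * cis (a * (v * \<theta>))"
      unfolding cis_conv_exp exp_add[symmetric] by (simp only: of_real_mult distrib_left mult_ac)
    also have "exp (of_real (a * ln (l * t))) = (of_real ((l * t) powr a) :: complex)"
    proof -
      have "l * t \<noteq> 0" using l that by auto
      then show ?thesis unfolding exp_of_real by (simp only: powr_def if_False)
    qed
    finally show ?thesis .
  qed
  define f where "f q = exp (- c * q powr \<alpha>) * q powr (- s)" for q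
  have F: "stable_mgf c \<alpha> (of_real t * Complex \<kappa> v) * (of_real t * Complex \<kappa> v) powr of_real (- s)
      = cis (- s * (v * \<theta>)) * of_real (f (l * t))" if "t > 0" "v = 1 \<or> v = - 1" for t v
  proof -
    have "\<alpha> * (v * \<theta>) = v * pi" using \<alpha> by (simp add: \<theta>_def)
    then have "cis (\<alpha> * (v * \<theta>)) = - 1" using that by (auto simp: complex_eq_iff)
    then show ?thesis unfolding stable_mgf_def powr[OF that]
      by (simp add: f_def exp_of_real[symmetric])
  qed
  define J where "J = (\<integral>q\<in>{0<..}. f q \<partial>lborel)"
  have ray: "(\<integral>t\<in>{0<..}. stable_mgf c \<alpha> (of_real t * Complex \<kappa> v) * (of_real t * Complex \<kappa> v) powr of_real (- s) \<partial>lborel)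
      = cis (- s * (v * \<theta>)) * of_real (J / l)" if v: "v = 1 \<or> v = - 1" for v
  proof -
    have "J = l * (\<integral>t\<in>{0<..}. f (l * t) \<partial>lborel)"
    proof -
      have "J = l * (\<integral>t. indicator {0<..} (l * t) * f (l * t) \<partial>lborel)"
        unfolding J_def set_lebesgue_integral_def
        by (subst lborel_integral_real_affine[where c = l and t = 0]) (use l in auto)
      also have "(\<lambda>t. indicator {0<..} (l * t) * f (l * t)) = (\<lambda>t. indicator {0<..} t * f (l * t))"
        using l by (auto simp: fun_eq_iff indicator_def zero_less_mult_iff)
      finally show ?thesis by (simp add: set_lebesgue_integral_def)
    qed
    moreover have "(\<integral>t\<in>{0<..}. stable_mgf c \<alpha> (of_real t * Complex \<kappa> v) * (of_real t * Complex \<kappa> v) powr of_real (- s) \<partial>lborel)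
      = (\<integral>t\<in>{0<..}. cis (- s * (v * \<theta>)) * of_real (f (l * t)) \<partial>lborel)"
      by (intro set_lebesgue_integral_cong allI impI F v) auto
    moreover have "\<dots> = cis (- s * (v * \<theta>)) * of_real (\<integral>t\<in>{0<..}. f (l * t) \<partial>lborel)"
      by (simp add: set_integral_complex_of_real)
    ultimately show ?thesis using l by simp
  qed
  have w: "Complex \<kappa> v = of_real l * cis (v * \<theta>)" if v: "v = 1 \<or> v = - 1" for v
    using powr[of 1 v 1, OF _ v] l v by (auto simp: complex_eq_iff)
  have "\<i> * hankel s = Complex \<kappa> 1 * (cis (- s * (1 * \<theta>)) * of_real (J / l))
      - Complex \<kappa> (- 1) * (cis (- s * (- 1 * \<theta>)) * of_real (J / l))"
    using sc.vertical_line_eq_rays unfolding hankel_def ray[of 1, OF disjI1[OF refl]] ray[of "- 1", OF disjI2[OF refl]] .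
  also have "\<dots> = of_real J * (cis \<theta> * cis (- s * \<theta>) - cis (- \<theta>) * cis (s * \<theta>))"
  proof -
    have "of_real l * of_real (J / l) = (of_real J :: complex)" using l by simp
    then show ?thesis using l w[of 1] w[of "- 1"] by (simp add: algebra_simps)
  qed
  also have "\<dots> = of_real J * (cis ((1 - s) * \<theta>) - cis (- ((1 - s) * \<theta>)))"
    by (simp add: cis_mult algebra_simps)
  also have "\<dots> = \<i> * of_real (2 * sin ((1 - s) * \<theta>) * J)"
    by (simp add: complex_eq_iff)
  finally have "hankel s = of_real (2 * sin ((1 - s) * \<theta>) * J)" by simp
  also have "2 * sin ((1 - s) * \<theta>) * J = 2 * pi / \<alpha> * c powr ((s - 1) / \<alpha>) * rGamma (1 + (s - 1) / \<alpha>)"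
  proof -
    define z where "z = (1 - s) / \<alpha>"
    have z: "z > 0" using s \<alpha> by (simp add: z_def)
    have J: "J = 1 / \<alpha> * c powr (- z) * Gamma z"
      unfolding J_def f_def z_def using c \<alpha> s by (intro powr_stretched_exp_integral) auto
    \<comment> \<open>Cancelling Gamma z in the reflection formula rGamma z rGamma(1 - z) = sin(pi
      z) / pi produces exactly the product sin times Gamma found on the rays.\<close>
    have "Gamma z * rGamma z = 1" using z by (simp add: rGamma_inverse_Gamma Gamma_eq_zero_iff nonpos_Ints_def)
    then have "rGamma (1 - z) = Gamma z * (sin (pi * z) / pi)"
      unfolding rGamma_reflection_real[symmetric] by (simp add: mult.assoc[symmetric])
    moreover have "(1 - s) * \<theta> = pi * z" "(s - 1) / \<alpha> = - z"
      by (auto simp: \<theta>_def z_def field_simps diff_divide_distrib)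
    ultimately show ?thesis unfolding J by simp
  qed
  finally show ?thesis .
qed

text \<open>Continuity supplies the value at $s = 1$, where the recurrence loses its left-hand side.\<close>

lemma continuous_hankel: "continuous_on {0..1} hankel"
proof -
  obtain C where C: "C > 0" "\<And>k. norm (stable_mgf c \<alpha> (Complex \<gamma> k)) \<le> C * exp (- 1 * norm (Complex \<gamma> k))"
    using stable_line_bound[of 1] by blast
  \<comment> \<open>A bound uniform in s: \<gamma>^(-s) lies between its values 1 and 1/\<gamma> at
    the two ends of [0, 1].\<close>
  have le: "norm (Complex \<gamma> k) powr (- s) \<le> max 1 (1 / \<gamma>)" if "s \<in> {0..1}" for s k
  proof -
    have "norm (Complex \<gamma> k) powr (- s) \<le> \<gamma> powr (- s)"
      using that \<gamma> \<gamma>_le_norm_line(1) by (intro powr_mono2') auto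
    also have "\<dots> \<le> max 1 (1 / \<gamma>)"
    proof (cases "\<gamma> \<ge> 1")
      case True
      then have "\<gamma> powr (- s) \<le> \<gamma> powr 0" using that by (intro powr_mono) auto
      then show ?thesis using True by simp
    next
      case False
      then have "\<gamma> powr (- s) \<le> \<gamma> powr (- 1)" using that \<gamma> by (intro powr_mono') auto
      then show ?thesis using \<gamma> by (simp add: powr_minus_divide)
    qed
    finally show ?thesis .
  qed
  show ?thesis
    unfolding continuous_on_sequentially
  proof (intro allI ballI impI)
    fix x :: "nat \<Rightarrow> real" and a assume "a \<in> {0..1}" "(\<forall>n. x n \<in> {0..1}) \<and> x \<longlonglongrightarrow> a"
    then have a: "a \<in> {0..1}" "\<forall>n. x n \<in> {0..1}" "x \<longlonglongrightarrow> a" by auto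
    show "(hankel \<circ> x) \<longlonglongrightarrow> hankel a"
      unfolding hankel_def o_def
    proof (rule integral_dominated_convergence)
      show "integrable lborel (\<lambda>k. C * max 1 (1 / \<gamma>) * exp (- \<bar>k::real\<bar>))"
        using exp_minus_abs_integrable by simp
      show "AE k in lborel. norm (stable_mgf c \<alpha> (Complex \<gamma> k) * Complex \<gamma> k powr of_real (- x n))
          \<le> C * max 1 (1 / \<gamma>) * exp (- \<bar>k\<bar>)" for n
      proof (rule AE_I2)
        fix k
        have "norm (stable_mgf c \<alpha> (Complex \<gamma> k) * Complex \<gamma> k powr of_real (- x n))
            \<le> (C * exp (- \<bar>k\<bar>)) * max 1 (1 / \<gamma>)"
          unfolding norm_mult norm_powr_line
        proof (intro mult_mono le)
          have "C * exp (- 1 * norm (Complex \<gamma> k)) \<le> C * exp (- \<bar>k\<bar>)"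
            using C \<gamma>_le_norm_line[of k] by (intro mult_left_mono) auto
          with C(2)[of k] show "norm (stable_mgf c \<alpha> (Complex \<gamma> k)) \<le> C * exp (- \<bar>k\<bar>)" by linarith
        qed (use a C in auto)
        then show "norm (stable_mgf c \<alpha> (Complex \<gamma> k) * Complex \<gamma> k powr of_real (- x n))
            \<le> C * max 1 (1 / \<gamma>) * exp (- \<bar>k\<bar>)" by (simp add: mult_ac)
      qed
      show "AE k in lborel. (\<lambda>n. stable_mgf c \<alpha> (Complex \<gamma> k) * Complex \<gamma> k powr of_real (- x n))
          \<longlonglongrightarrow> stable_mgf c \<alpha> (Complex \<gamma> k) * Complex \<gamma> k powr of_real (- a)"
        unfolding powr_def using a(3) by (intro AE_I2) (auto intro!: tendsto_intros)
    qed (rule borel_measurable_integrable[OF hankel_integrable])+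
  qed
qed

text \<open>The right-hand side satisfies the recurrence of \<open>hankel\<close>, by rGamma z = z
  rGamma(1 + z) with z = (s - 1)/\<alpha>. The formula thus spreads from s < 1 upwards in steps of
  \<alpha>, except at s = 1, where the factor s - 1 vanishes and a limit from the left takes
  over.\<close>

proposition hankel_eq:
  "hankel s = of_real (2 * pi / \<alpha> * c powr ((s - 1) / \<alpha>) * rGamma (1 + (s - 1) / \<alpha>))" (is "_ = of_real (?R s)")
proof -
  have at_1: "hankel 1 = of_real (?R 1)"
  proof -
    define x where "x n = 1 - 1 / real (Suc n)" for n
    have x: "x \<longlonglongrightarrow> 1" unfolding x_def by real_asymp
    have x01: "x n \<in> {0..1}" "x n < 1" for n by (auto simp: x_def)
    have "(\<lambda>n. hankel (x n)) \<longlonglongrightarrow> hankel 1"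
      by (rule continuous_on_tendsto_compose[OF continuous_hankel x]) (use x01 in auto)
    moreover have "isCont ?R 1" using c \<alpha> by (intro continuous_intros) auto
    then have "(\<lambda>n. of_real (?R (x n))) \<longlonglongrightarrow> (of_real (?R 1) :: complex)"
      by (intro tendsto_of_real isCont_tendsto_compose[OF _ x])
    then have "(\<lambda>n. hankel (x n)) \<longlonglongrightarrow> of_real (?R 1)"
      using hankel_less_1[OF x01(2)] by simp
    ultimately show ?thesis by (rule LIMSEQ_unique)
  qed
  \<comment> \<open>Each induction step adds a strip of width \<alpha>, the amount by which the
    recurrence lowers the exponent.\<close>
  have "\<forall>s < 1 + real j * \<alpha>. hankel s = of_real (?R s)" for j
  proof (induction j)
    case (Suc j)
    show ?case
    proof (intro allI impI)
      fix s assume s: "s < 1 + real (Suc j) * \<alpha>"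
      consider "s < 1" | "s = 1" | "s > 1" by linarith
      then show "hankel s = of_real (?R s)"
      proof cases
        case 3
        have IH: "hankel (s - \<alpha>) = of_real (?R (s - \<alpha>))" using Suc s by (auto simp: algebra_simps)
        have "of_real (s - 1) * hankel s = of_real (c * \<alpha>) * hankel (s - \<alpha>)"
          using hankel_recurrence[of "s - 1"] by simp
        also have "\<dots> = of_real (c * \<alpha> * ?R (s - \<alpha>))" by (simp add: IH)
        also have "c * \<alpha> * ?R (s - \<alpha>) = (s - 1) * ?R s"
        proof -
          define z where "z = (s - 1) / \<alpha>"
          have z: "(s - \<alpha> - 1) / \<alpha> = z - 1" "s - 1 = \<alpha> * z"
            using \<alpha> by (auto simp: z_def field_simps)
          have "rGamma z = z * rGamma (1 + z)" by (metis rGamma_plus1 add.commute)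
          moreover have "c powr (z - 1) * c = c powr z" using c by (simp add: powr_diff)
          ultimately show ?thesis using \<alpha> unfolding z z_def[symmetric] by (simp add: field_simps)
        qed
        finally have "of_real (s - 1) * hankel s = of_real (s - 1) * of_real (?R s)" by simp
        moreover have "of_real (s - 1) \<noteq> (0 :: complex)" using 3 by simp
        ultimately show ?thesis using mult_left_cancel by blast
      qed (use hankel_less_1 at_1 in auto)
    qed
  qed (use hankel_less_1 in auto)
  moreover obtain j where "s - 1 < real j * \<alpha>" using \<alpha> reals_Archimedean3[of \<alpha>] by auto
  ultimately show ?thesis by (auto simp: algebra_simps)
qed

end

subsection \<open>The tail of the stable law\<close>

lemma integral_split_at_0:
  fixes f :: "real \<Rightarrow> complex"
  assumes pos: "set_integrable lborel {0<..} f" and neg: "set_integrable lborel {0<..} (\<lambda>t. f (- t))"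
  shows "integrable lborel f"
    "(\<integral>k. f k \<partial>lborel) = (\<integral>t\<in>{0<..}. f t \<partial>lborel) + (\<integral>t\<in>{0<..}. f (- t) \<partial>lborel)"
proof -
  let ?n = "\<lambda>t. indicator {0<..} t *\<^sub>R f (- t)"
  have n: "integrable lborel (\<lambda>k. ?n (- k))"
    using neg lborel_integrable_real_affine_iff[of "- 1" ?n 0] by (simp add: set_integrable_def)
  have n_eq: "(\<integral>k. ?n (- k) \<partial>lborel) = (\<integral>t\<in>{0<..}. f (- t) \<partial>lborel)"
    using lborel_integral_real_affine[of "- 1" ?n 0] by (simp add: set_lebesgue_integral_def)
  have eq: "AE k in lborel. f k = indicator {0<..} k *\<^sub>R f k + ?n (- k)"
    using AE_lborel_singleton[of 0] by eventually_elim (auto split: split_indicator)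
  have int: "integrable lborel (\<lambda>k. indicator {0<..} k *\<^sub>R f k + ?n (- k))"
    using pos n by (auto simp: set_integrable_def)
  have m: "f \<in> borel_measurable lborel"
  proof -
    \<comment> \<open>Measurability of f is recovered from its two halves; the single value at 0 is
      patched by hand.\<close>
    have "f = (\<lambda>k. if k = 0 then f 0 else indicator {0<..} k *\<^sub>R f k + ?n (- k))"
      by (auto simp: fun_eq_iff split: split_indicator)
    moreover have "\<dots> \<in> borel_measurable lborel"
      using borel_measurable_integrable[OF int] by (intro measurable_If) auto
    ultimately show ?thesis by simp
  qed
  show "integrable lborel f"
    using int m eq by (subst integrable_cong_AE[of f]) auto
  have "(\<integral>k. f k \<partial>lborel) = (\<integral>k. indicator {0<..} k *\<^sub>R f k + ?n (- k) \<partial>lborel)"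
    using eq m borel_measurable_integrable[OF int] by (intro integral_cong_AE) auto
  also have "\<dots> = (\<integral>t\<in>{0<..}. f t \<partial>lborel) + (\<integral>k. ?n (- k) \<partial>lborel)"
    using pos n unfolding set_integrable_def set_lebesgue_integral_def
    by (rule Bochner_Integration.integral_add)
  finally show "(\<integral>k. f k \<partial>lborel) = (\<integral>t\<in>{0<..}. f t \<partial>lborel) + (\<integral>t\<in>{0<..}. f (- t) \<partial>lborel)"
    by (simp only: n_eq)
qed

text \<open>The mean value inequality on a disc. The factor |z - w| is what cancels the pole of the
  inversion kernel at the origin.\<close>

lemma norm_exp_diff_le: "norm (exp z - exp w) \<le> norm (z - w) * exp (max (norm z) (norm w))" for z w :: complex
proof -
  have "norm (exp z - exp w) \<le> exp (max (norm z) (norm w)) * norm (z - w)"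
  proof (rule field_differentiable_bound[of "cball 0 (max (norm z) (norm w))" exp exp])
    fix x :: complex assume "x \<in> cball 0 (max (norm z) (norm w))"
    then have "norm x \<le> max (norm z) (norm w)" by simp
    then show "norm (exp x) \<le> exp (max (norm z) (norm w))"
      using norm_exp[of x] by (meson exp_le_cancel_iff order_trans)
    show "(exp has_field_derivative exp x) (at x within cball 0 (max (norm z) (norm w)))"
      by (intro DERIV_exp has_field_derivative_at_within)
  qed auto
  then show ?thesis by (simp add: mult.commute)
qed

context stable_line
begin

text \<open>The contour formula for P(X > a), with dp = i dk leaving 1/(2 pi). It involves no
  distribution; the identification with a probability is \<open>tail_eq\<close>.\<close>

definition tail :: "real \<Rightarrow> complex" where
  "tail a = (\<integral>k. stable_mgf c \<alpha> (Complex \<gamma> k) * (exp (- of_real a * Complex \<gamma> k) / Complex \<gamma> k) \<partial>lborel)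
              / of_real (2 * pi)"

lemma norm_exp_line: "norm (exp (of_real a * Complex \<gamma> k)) = exp (a * \<gamma>)"
  by (simp add: norm_exp_eq_Re)

lemma tail_kernel_bound: "norm (exp (- of_real a * Complex \<gamma> k) / Complex \<gamma> k) \<le> exp (- a * \<gamma>) / \<gamma>"
  using norm_exp_line[of "- a" k] \<gamma> \<gamma>_le_norm_line(1)[of k]
  by (simp add: norm_divide frac_le)

lemma tail_integrable:
  "integrable lborel (\<lambda>k. stable_mgf c \<alpha> (Complex \<gamma> k) * (exp (- of_real a * Complex \<gamma> k) / Complex \<gamma> k))"
proof (rule stable_line_integrable[where A = 0])
  show "norm (exp (- of_real a * Complex \<gamma> k) / Complex \<gamma> k) \<le> exp (- a * \<gamma>) / \<gamma> * exp (0 * norm (Complex \<gamma> k))" for k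
    using tail_kernel_bound[of a k] by simp
qed measurable

lemma norm_stable_line_integrable: "integrable lborel (\<lambda>k. norm (stable_mgf c \<alpha> (Complex \<gamma> k)))"
  using stable_line_integrable[of "\<lambda>_. 1" 1 0] by (intro integrable_norm) simp

text \<open>On the line |e^(-a p)| is the constant e^(-a \<gamma>), and |p| \<ge> \<gamma>. The
  decay for large a is what moving off the imaginary axis gains.\<close>

lemma tail_bound: "\<exists>D. \<forall>a. norm (tail a) \<le> D * exp (- a * \<gamma>)"
proof (intro exI allI)
  let ?I = "\<integral>k. norm (stable_mgf c \<alpha> (Complex \<gamma> k)) \<partial>lborel"
  fix a
  have "norm (\<integral>k. stable_mgf c \<alpha> (Complex \<gamma> k) * (exp (- of_real a * Complex \<gamma> k) / Complex \<gamma> k) \<partial>lborel)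
      \<le> (\<integral>k. norm (stable_mgf c \<alpha> (Complex \<gamma> k)) * (exp (- a * \<gamma>) / \<gamma>) \<partial>lborel)"
  proof (rule Bochner_Integration.integral_norm_bound_integral[OF tail_integrable])
    show "integrable lborel (\<lambda>k. norm (stable_mgf c \<alpha> (Complex \<gamma> k)) * (exp (- a * \<gamma>) / \<gamma>))"
      using norm_stable_line_integrable by (rule integrable_mult_left)
    show "norm (stable_mgf c \<alpha> (Complex \<gamma> k) * (exp (- of_real a * Complex \<gamma> k) / Complex \<gamma> k))
        \<le> norm (stable_mgf c \<alpha> (Complex \<gamma> k)) * (exp (- a * \<gamma>) / \<gamma>)" for k
      unfolding norm_mult[of "stable_mgf c \<alpha> (Complex \<gamma> k)"] by (intro mult_left_mono tail_kernel_bound norm_ge_zero)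
  qed
  also have "\<dots> = ?I / \<gamma> * exp (- a * \<gamma>)" by simp
  finally have "norm (tail a) \<le> (?I / \<gamma> * exp (- a * \<gamma>)) / (2 * pi)" (is "?l \<le> ?r")
    unfolding tail_def norm_divide norm_of_real by (rule order_trans[OF divide_right_mono]) auto
  also have "?r = ?I / \<gamma> / (2 * pi) * exp (- a * \<gamma>)" by simp
  finally show "norm (tail a) \<le> ?I / \<gamma> / (2 * pi) * exp (- a * \<gamma>)" .
qed

lemma tail_tendsto:
  assumes "x \<longlonglongrightarrow> a"
  shows "(\<lambda>n. tail (x n)) \<longlonglongrightarrow> tail a"
  unfolding tail_def
proof (intro tendsto_divide tendsto_const)
  obtain M where M: "\<And>n. \<bar>x n\<bar> \<le> M"
    using convergent_imp_Bseq[OF convergentI[OF assms]] by (auto simp: Bseq_def)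
  show "(\<lambda>n. \<integral>k. stable_mgf c \<alpha> (Complex \<gamma> k) * (exp (- of_real (x n) * Complex \<gamma> k) / Complex \<gamma> k) \<partial>lborel)
     \<longlonglongrightarrow> (\<integral>k. stable_mgf c \<alpha> (Complex \<gamma> k) * (exp (- of_real a * Complex \<gamma> k) / Complex \<gamma> k) \<partial>lborel)"
  proof (rule integral_dominated_convergence)
    show "integrable lborel (\<lambda>k. norm (stable_mgf c \<alpha> (Complex \<gamma> k)) * (exp (M * \<gamma>) / \<gamma>))"
      using norm_stable_line_integrable by simp
    show "AE k in lborel. norm (stable_mgf c \<alpha> (Complex \<gamma> k) * (exp (- of_real (x n) * Complex \<gamma> k) / Complex \<gamma> k))
        \<le> norm (stable_mgf c \<alpha> (Complex \<gamma> k)) * (exp (M * \<gamma>) / \<gamma>)" for n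
    proof (rule AE_I2)
      fix k
      have "exp (- x n * \<gamma>) / \<gamma> \<le> exp (M * \<gamma>) / \<gamma>"
        using M[of n] \<gamma> mult_right_mono[of "- x n" M \<gamma>] by (intro divide_right_mono) auto
      then show "norm (stable_mgf c \<alpha> (Complex \<gamma> k) * (exp (- of_real (x n) * Complex \<gamma> k) / Complex \<gamma> k))
        \<le> norm (stable_mgf c \<alpha> (Complex \<gamma> k)) * (exp (M * \<gamma>) / \<gamma>)"
        unfolding norm_mult[of "stable_mgf c \<alpha> (Complex \<gamma> k)"]
        by (intro mult_left_mono order_trans[OF tail_kernel_bound]) auto
    qed
    show "AE k in lborel. (\<lambda>n. stable_mgf c \<alpha> (Complex \<gamma> k) * (exp (- of_real (x n) * Complex \<gamma> k) / Complex \<gamma> k))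
        \<longlonglongrightarrow> stable_mgf c \<alpha> (Complex \<gamma> k) * (exp (- of_real a * Complex \<gamma> k) / Complex \<gamma> k)"
      using assms by (intro AE_I2 tendsto_intros) auto
  qed (rule borel_measurable_integrable[OF tail_integrable])+
qed (use pi_gt_zero in auto)

text \<open>With \<kappa> = 0 the two rays are the halves of the imaginary axis. The difference of
  exponentials divided by p is at most |b - a| e^(A |p|), so there is no singularity at the origin
  (s = 0) and the line may be moved to Re p = \<gamma>. Only there is the kernel split into two
  separately integrable terms.\<close>

lemma imaginary_axis_integral:
  fixes a b :: real
  defines "h \<equiv> \<lambda>k. (iexp (- (k * a)) - iexp (- (k * b))) / (\<i> * of_real k) * stable_mgf c \<alpha> (\<i> * of_real k)"
  shows "integrable lborel h" "(\<integral>k. h k \<partial>lborel) = of_real (2 * pi) * (tail a - tail b)"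
proof -
  define F where "F p = stable_mgf c \<alpha> p * ((exp (- of_real a * p) - exp (- of_real b * p)) / p)" for p
  let ?A = "max \<bar>a\<bar> \<bar>b\<bar>"
  obtain C where "sector_contour F \<gamma> 0 0 C"
    unfolding F_def[abs_def]
  proof (rule sector_contour_stable[where \<kappa> = 0])
    show "(\<lambda>p. (exp (- of_real a * p) - exp (- of_real b * p)) / p) holomorphic_on (- \<real>\<^sub>\<le>\<^sub>0)"
      by (intro holomorphic_intros) auto
    fix p :: complex assume "p \<notin> \<real>\<^sub>\<le>\<^sub>0"
    then have p: "norm p > 0" by auto
    have "max (norm (- of_real a * p)) (norm (- of_real b * p)) = ?A * norm p"
      by (simp add: norm_mult max_mult_distrib_right)
    moreover have "- of_real a * p - - of_real b * p = of_real (b - a) * p" by (simp add: algebra_simps)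
    ultimately have "norm (exp (- of_real a * p) - exp (- of_real b * p)) \<le> \<bar>b - a\<bar> * norm p * exp (?A * norm p)"
      using norm_exp_diff_le[of "- of_real a * p" "- of_real b * p"]
      by (simp only: norm_mult norm_of_real)
    then show "norm ((exp (- of_real a * p) - exp (- of_real b * p)) / p)
        \<le> \<bar>b - a\<bar> * norm p powr (- 0) * exp (?A * norm p)"
      using p by (simp add: norm_divide field_simps)
  qed (use sector_slope(1)[OF \<alpha>] in auto)
  then interpret sc: sector_contour F \<gamma> 0 0 C .
  have F_h: "F (of_real t * Complex 0 v) = h (v * t)" if "t > 0" "\<bar>v\<bar> = 1" for t v
  proof -
    have *: "of_real t * Complex 0 v = \<i> * of_real (v * t)" by (simp add: complex_eq_iff)
    show ?thesis unfolding F_def h_def * by (simp add: algebra_simps)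
  qed
  have pos: "set_integrable lborel {0<..} h"
    using sc.integrable_ray[of 1] by (rule set_integrable_cong[THEN iffD1, rotated 3]) (auto simp: F_h)
  have neg: "set_integrable lborel {0<..} (\<lambda>t. h (- t))"
    using sc.integrable_ray[of "- 1"] by (rule set_integrable_cong[THEN iffD1, rotated 3]) (auto simp: F_h)
  show "integrable lborel h" using pos neg by (rule integral_split_at_0)
  have r1: "(\<integral>t\<in>{0<..}. F (of_real t * Complex 0 1) \<partial>lborel) = (\<integral>t\<in>{0<..}. h t \<partial>lborel)"
    by (intro set_lebesgue_integral_cong) (auto simp: F_h)
  have r2: "(\<integral>t\<in>{0<..}. F (of_real t * Complex 0 (- 1)) \<partial>lborel) = (\<integral>t\<in>{0<..}. h (- t) \<partial>lborel)"
    by (intro set_lebesgue_integral_cong) (auto simp: F_h)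
  have c1: "Complex 0 1 = \<i>" "Complex 0 (- 1) = - \<i>" by (auto simp: complex_eq_iff)
  have "\<i> * (\<integral>k. F (Complex \<gamma> k) \<partial>lborel) = \<i> * (\<integral>k. h k \<partial>lborel)"
    using sc.vertical_line_eq_rays unfolding r1 r2 integral_split_at_0(2)[OF pos neg]
    unfolding c1 by (simp add: algebra_simps)
  then have "(\<integral>k. h k \<partial>lborel) = (\<integral>k. F (Complex \<gamma> k) \<partial>lborel)" by simp
  also have "\<dots> = (\<integral>k. stable_mgf c \<alpha> (Complex \<gamma> k) * (exp (- of_real a * Complex \<gamma> k) / Complex \<gamma> k)
      - stable_mgf c \<alpha> (Complex \<gamma> k) * (exp (- of_real b * Complex \<gamma> k) / Complex \<gamma> k) \<partial>lborel)"
    unfolding F_def by (simp only: diff_divide_distrib right_diff_distrib)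
  also have "\<dots> = of_real (2 * pi) * tail a - of_real (2 * pi) * tail b"
    by (subst Bochner_Integration.integral_diff[OF tail_integrable tail_integrable]) (simp add: tail_def)
  finally show "(\<integral>k. h k \<partial>lborel) = of_real (2 * pi) * (tail a - tail b)" by (simp add: right_diff_distrib)
qed

end

section \<open>Contour integral and tail probability\<close>

locale stable_distribution = stable_line + real_distribution +
  assumes char_stable: "\<And>k. char M k = stable_mgf c \<alpha> (\<i> * of_real k)"
begin

lemma cdf_diff_tail:
  assumes "a < b" "measure M {a} = 0" "measure M {b} = 0"
  shows "of_real (cdf M b - cdf M a) = tail a - tail b"
proof -
  interpret finite_borel_measure M by (rule finite_borel_measure_M)
  let ?h = "\<lambda>k. (iexp (- (k * a)) - iexp (- (k * b))) / (\<i> * of_real k) * stable_mgf c \<alpha> (\<i> * of_real k)"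
  have "(\<lambda>T. 1 / (2 * pi) * (CLBINT t=-T..T. ?h t)) \<longlonglongrightarrow> measure M {a<..b}"
    using Levy_Inversion[of a b] assms by (simp add: char_stable)
  moreover have "(CLBINT t=-(real n)..real n. ?h t) = (\<integral>t. indicator {- real n..real n} t *\<^sub>R ?h t \<partial>lborel)" for n
    by (subst interval_integral_Icc) (auto simp: set_lebesgue_integral_def)
  ultimately have "(\<lambda>n. 1 / (2 * pi) * (\<integral>t. indicator {- real n..real n} t *\<^sub>R ?h t \<partial>lborel)) \<longlonglongrightarrow> of_real (measure M {a<..b})"
    by simp
  \<comment> \<open>The inversion formula gives only a limit over symmetric intervals. Since the
    integrand is integrable, that limit is the genuine integral already evaluated.\<close>
  moreover have "(\<lambda>n. 1 / (2 * pi) * (\<integral>t. indicator {- real n..real n} t *\<^sub>R ?h t \<partial>lborel))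
      \<longlonglongrightarrow> 1 / (2 * pi) * (\<integral>k. ?h k \<partial>lborel)"
    by (intro tendsto_mult tendsto_const tendsto_integral_symmetric_interval imaginary_axis_integral)
  ultimately have "of_real (measure M {a<..b}) = 1 / (2 * pi) * (\<integral>k. ?h k \<partial>lborel)"
    by (rule LIMSEQ_unique)
  then show ?thesis
    unfolding imaginary_axis_integral(2) using cdf_diff_eq[OF assms(1)] by simp
qed

text \<open>A finite measure has only countably many atoms, and an open interval is uncountable. It
  supplies the continuity points that the inversion formula demands.\<close>

lemma non_atom_between:
  assumes "a < b"
  shows "\<exists>x. a < x \<and> x < b \<and> measure M {x} = 0"
  using open_minus_countable[OF countable_support, of "{a<..<b}"] assms by auto

text \<open>For a non-atom a, the right end point runs to infinity through non-atoms. A general a is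
  approached from the right by non-atoms: there the distribution function is continuous, and so is
  the contour integral. In particular the formula holds with strict inequality X > a.\<close>

lemma tail_eq: "tail a = of_real (measure M {a<..})"
proof -
  interpret finite_borel_measure M by (rule finite_borel_measure_M)
  have cont: "of_real (1 - cdf M a) = tail a" if a: "measure M {a} = 0" for a
  proof -
    have "\<exists>x. a + real n < x \<and> x < a + real n + 1 \<and> measure M {x} = 0" for n
      by (intro non_atom_between) simp
    then obtain b where b: "\<And>n. a + real n < b n" "\<And>n. measure M {b n} = 0" by metis
    have ab: "a < b n" for n using b(1)[of n] by linarith
    have b_lim: "filterlim b at_top sequentially"
    proof (rule filterlim_at_top_mono)
      show "filterlim (\<lambda>n. a + real n) at_top sequentially" by real_asymp
      show "\<forall>\<^sub>F n in sequentially. a + real n \<le> b n" by (intro always_eventually allI less_imp_le b(1))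
    qed
    have "(\<lambda>n. cdf M (b n)) \<longlonglongrightarrow> 1" by (rule filterlim_compose[OF cdf_lim_at_top_prob b_lim])
    then have "(\<lambda>n. of_real (cdf M (b n) - cdf M a)) \<longlonglongrightarrow> (of_real (1 - cdf M a) :: complex)"
      by (intro tendsto_of_real tendsto_diff tendsto_const)
    then have "(\<lambda>n. tail a - tail (b n)) \<longlonglongrightarrow> of_real (1 - cdf M a)"
      by (simp only: cdf_diff_tail[OF ab a b(2)])
    moreover have "(\<lambda>n. tail (b n)) \<longlonglongrightarrow> 0"
    proof -
      obtain D where D: "\<And>a. norm (tail a) \<le> D * exp (- a * \<gamma>)" using tail_bound by auto
      have "((\<lambda>x. D * exp (- x * \<gamma>)) \<longlongrightarrow> 0) at_top" using \<gamma> by real_asymp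
      then have "(\<lambda>n. D * exp (- b n * \<gamma>)) \<longlonglongrightarrow> 0" by (rule filterlim_compose[OF _ b_lim])
      then show ?thesis using D by (intro Lim_null_comparison[of "\<lambda>n. tail (b n)"]) auto
    qed
    then have "(\<lambda>n. tail a - tail (b n)) \<longlonglongrightarrow> tail a - 0" by (intro tendsto_diff tendsto_const)
    ultimately have "of_real (1 - cdf M a) = tail a - 0" by (rule LIMSEQ_unique)
    then show ?thesis by simp
  qed
  have "\<exists>x. a < x \<and> x < a + 1 / real (Suc n) \<and> measure M {x} = 0" for n
    by (intro non_atom_between) simp
  then obtain x where x: "\<And>n. a < x n" "\<And>n. x n < a + 1 / real (Suc n)" "\<And>n. measure M {x n} = 0" by metis
  have x_lim: "x \<longlonglongrightarrow> a"
  proof (rule tendsto_sandwich[of "\<lambda>_. a" x _ "\<lambda>n. a + 1 / real (Suc n)"])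
    show "(\<lambda>n. a + 1 / real (Suc n)) \<longlonglongrightarrow> a" by real_asymp
  qed (use x in \<open>auto intro!: always_eventually less_imp_le\<close>)
  then have "filterlim x (at_right a) sequentially"
    using x(1) by (auto simp: filterlim_at intro!: always_eventually less_imp_neq[THEN not_sym])
  moreover have "(cdf M \<longlongrightarrow> cdf M a) (at_right a)"
    using cdf_is_right_cont[of a] by (simp add: continuous_within)
  ultimately have "(\<lambda>n. cdf M (x n)) \<longlonglongrightarrow> cdf M a"
    by (rule filterlim_compose[rotated])
  then have "(\<lambda>n. of_real (1 - cdf M (x n))) \<longlonglongrightarrow> (of_real (1 - cdf M a) :: complex)"
    by (intro tendsto_of_real tendsto_diff tendsto_const)
  then have "(\<lambda>n. tail (x n)) \<longlonglongrightarrow> of_real (1 - cdf M a)" using cont[OF x(3)] by simp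
  moreover have "(\<lambda>n. tail (x n)) \<longlonglongrightarrow> tail a" by (rule tail_tendsto[OF x_lim])
  ultimately have "tail a = of_real (1 - cdf M a)" by (rule LIMSEQ_unique[rotated])
  moreover have "measure M {a<..} = 1 - cdf M a"
  proof -
    have "{a<..} = space M - {..a}" by auto
    then show ?thesis using prob_compl[of "{..a}"] by (simp add: cdf_def)
  qed
  ultimately show ?thesis by simp
qed

end

subsection \<open>The exponential payoff and its double series\<close>

text \<open>The real half-line is the ray with direction w = 1, and -e^(-q z)/q is an explicit
  primitive.\<close>

lemma exp_set_integral:
  fixes q :: complex
  assumes "Re q > 0"
  shows "set_integrable lborel {0<..} (\<lambda>t. exp (- q * of_real t))"
    "(\<integral>t\<in>{0<..}. exp (- q * of_real t) \<partial>lborel) = 1 / q"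
proof -
  have *: "set_integrable lborel {0<..} (\<lambda>t. exp (- (t * Re q)))"
    by (rule integrable_I0i_exp_mscale[OF assms])
  have m: "(\<lambda>t. exp (- q * of_real t)) \<in> borel_measurable lborel" by measurable
  show int: "set_integrable lborel {0<..} (\<lambda>t. exp (- q * of_real t))"
    by (rule set_integrable_bound[OF *])
      (use m in \<open>auto simp: set_borel_measurable_def norm_exp_eq_Re mult.commute\<close>)
  have "q \<noteq> 0" using assms by auto
  define \<Phi> where "\<Phi> z = - exp (- q * z) / q" for z
  have lim1: "(\<lambda>n. \<Phi> (of_real (Suc n) * 1) - \<Phi> (of_real (1 / Suc n) * 1))
      \<longlonglongrightarrow> 1 * (\<integral>t\<in>{0<..}. exp (- q * (of_real t * 1)) \<partial>lborel)"
  proof (rule ray_FTC)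
    fix t :: real
    show "(\<Phi> has_field_derivative exp (- q * (of_real t * 1))) (at (of_real t * 1))"
      unfolding \<Phi>_def using \<open>q \<noteq> 0\<close> by (auto intro!: derivative_eq_intros)
  qed (use int in \<open>auto intro!: continuous_intros\<close>)
  have lim2: "(\<lambda>n. \<Phi> (of_real (Suc n) * 1) - \<Phi> (of_real (1 / Suc n) * 1)) \<longlonglongrightarrow> 0 - (- exp (- q * of_real 0) / q)"
  proof (rule tendsto_diff)
    have "(\<lambda>n. exp (- r * real (Suc n))) \<longlonglongrightarrow> 0" if "r > 0" for r :: real
      using that by real_asymp
    from tendsto_divide[OF this[OF assms] tendsto_const[of "norm q"]]
    have lim: "(\<lambda>n. exp (- Re q * real (Suc n)) / norm q) \<longlonglongrightarrow> 0" using \<open>q \<noteq> 0\<close> by simp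
    show "(\<lambda>n. \<Phi> (of_real (Suc n) * 1)) \<longlonglongrightarrow> 0"
      by (rule Lim_null_comparison[OF _ lim]) (simp add: \<Phi>_def norm_divide norm_exp_eq_Re)
    have "(\<lambda>n. 1 / real (Suc n)) \<longlonglongrightarrow> 0" by real_asymp
    then show "(\<lambda>n. \<Phi> (of_real (1 / Suc n) * 1)) \<longlonglongrightarrow> - exp (- q * of_real 0) / q"
      unfolding \<Phi>_def mult_1_right using \<open>q \<noteq> 0\<close> by (intro tendsto_intros) auto
  qed
  show "(\<integral>t\<in>{0<..}. exp (- q * of_real t) \<partial>lborel) = 1 / q"
    using LIMSEQ_unique[OF lim1 lim2] by simp
qed

lemma power_div_fact_le_exp:
  assumes "z \<ge> (0::real)"
  shows "z ^ n / fact n \<le> exp z"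
proof -
  have s: "(\<lambda>n. z ^ n / fact n) sums exp z" using exp_converges[of z] by (simp add: divide_inverse mult.commute)
  have "(\<Sum>k\<in>{n}. z ^ k / fact k) \<le> (\<Sum>k. z ^ k / fact k)"
    using assms s by (intro sum_le_suminf) (auto dest: sums_summable)
  then show ?thesis using sums_unique[OF s] by simp
qed

context stable_line
begin

lemma measurable_stable_line [measurable]:
  "(\<lambda>k. stable_mgf c \<alpha> (Complex \<gamma> k)) \<in> borel_measurable borel"
  by (rule borel_measurable_continuous_onI[OF continuous_on_stable_line])

text \<open>Fubini for the variables w and k. The product of e^(u w) and e^(-w p) has modulus
  e^(-(\<gamma> - u) w), so the double integral converges absolutely because u < \<gamma>; the inner
  integral over w is the elementary 1/(p - u).\<close>

lemma tail_laplace: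
  assumes u: "0 < u" "u < \<gamma>"
  shows "set_integrable lborel {0<..} (\<lambda>w. of_real (u * exp (u * w)) * tail (w - y))"
    "(\<integral>w\<in>{0<..}. of_real (u * exp (u * w)) * tail (w - y) \<partial>lborel) =
       (\<integral>k. stable_mgf c \<alpha> (Complex \<gamma> k) * (exp (of_real y * Complex \<gamma> k) / Complex \<gamma> k
          * (of_real u / (Complex \<gamma> k - of_real u))) \<partial>lborel) / of_real (2 * pi)"
proof -
  define h where "h = (\<lambda>(w, k). indicator {0<..} w *\<^sub>R (of_real (u * exp (u * w)) *
     (stable_mgf c \<alpha> (Complex \<gamma> k) * (exp (- of_real (w - y) * Complex \<gamma> k) / Complex \<gamma> k))))"
  define N where "N = (\<integral>k. norm (stable_mgf c \<alpha> (Complex \<gamma> k) * (1 / Complex \<gamma> k)) \<partial>lborel)"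
  have h_meas [measurable]: "h \<in> borel_measurable (lborel \<Otimes>\<^sub>M lborel)"
  proof -
    have [measurable]: "(\<lambda>x. Complex \<gamma> (snd x)) \<in> borel_measurable (lborel \<Otimes>\<^sub>M lborel)"
      unfolding Complex_eq by measurable
    have [measurable]: "(\<lambda>x. stable_mgf c \<alpha> (Complex \<gamma> (snd x))) \<in> borel_measurable (lborel \<Otimes>\<^sub>M lborel)"
      by (rule measurable_compose[OF _ measurable_stable_line]) measurable
    show ?thesis unfolding h_def case_prod_beta by measurable
  qed
  have h_w: "integrable lborel (\<lambda>k. h (w, k))" for w
    unfolding h_def prod.case by (intro integrable_scaleR_right integrable_mult_right tail_integrable)
  have h_w_eq: "(\<integral>k. h (w, k) \<partial>lborel) = indicator {0<..} w *\<^sub>R (of_real (u * exp (u * w)) * (of_real (2 * pi) * tail (w - y)))" for w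
    unfolding h_def prod.case integral_scaleR_right integral_mult_right_zero tail_def by simp
  have norm_h: "norm (h (w, k)) = indicator {0<..} w * (u * exp (y * \<gamma>) * exp (- (w * (\<gamma> - u))))
      * norm (stable_mgf c \<alpha> (Complex \<gamma> k) * (1 / Complex \<gamma> k))" for w k
  proof -
    have "exp (u * w) * exp (- (w - y) * \<gamma>) = exp (y * \<gamma>) * exp (- (w * (\<gamma> - u)))"
      unfolding exp_add[symmetric] by (simp add: algebra_simps)
    then show ?thesis
      using norm_exp_line[of "- (w - y)" k] u by (simp add: h_def norm_mult norm_divide mult_ac)
  qed
  have int: "integrable (lborel \<Otimes>\<^sub>M lborel) h"
  proof (rule lborel_pair.Fubini_integrable[OF h_meas])
    have "set_integrable lborel {0<..} (\<lambda>w. exp (- (w * (\<gamma> - u))))"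
      by (rule integrable_I0i_exp_mscale) (use u in auto)
    then have "set_integrable lborel {0<..} (\<lambda>w. u * exp (y * \<gamma>) * exp (- (w * (\<gamma> - u))))"
      by (rule set_integrable_mult_right)
    then show "integrable lborel (\<lambda>w. \<integral>k. norm (h (w, k)) \<partial>lborel)"
      unfolding norm_h by (simp add: set_integrable_def)
    show "AE w in lborel. integrable lborel (\<lambda>k. h (w, k))" using h_w by simp
  qed
  have "integrable lborel (\<lambda>w. \<integral>k. h (w, k) \<partial>lborel)"
    using lborel_pair.integrable_fst'[OF int] .
  then have *: "integrable lborel (\<lambda>w. 1 / of_real (2 * pi) *
      (indicator {0<..} w *\<^sub>R (of_real (u * exp (u * w)) * (of_real (2 * pi) * tail (w - y)))))"
    unfolding h_w_eq by (rule integrable_mult_right)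
  have "1 / of_real (2 * pi) * (i *\<^sub>R (e * (of_real (2 * pi) * z))) = i *\<^sub>R (e * z)" for i and e z :: complex
    by (simp add: scaleR_conv_of_real)
  with * show "set_integrable lborel {0<..} (\<lambda>w. of_real (u * exp (u * w)) * tail (w - y))"
    unfolding set_integrable_def by (simp only:)
  have "of_real (2 * pi) * (\<integral>w\<in>{0<..}. of_real (u * exp (u * w)) * tail (w - y) \<partial>lborel) = (\<integral>w. \<integral>k. h (w, k) \<partial>lborel \<partial>lborel)"
    unfolding h_w_eq set_lebesgue_integral_def integral_mult_right_zero[symmetric] by (simp add: mult_ac)
  also have "\<dots> = (\<integral>k. \<integral>w. h (w, k) \<partial>lborel \<partial>lborel)"
    using lborel_pair.Fubini_integral[of "\<lambda>w k. h (w, k)"] int by simp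
  also have "\<dots> = (\<integral>k. stable_mgf c \<alpha> (Complex \<gamma> k) * (exp (of_real y * Complex \<gamma> k) / Complex \<gamma> k
          * (of_real u / (Complex \<gamma> k - of_real u))) \<partial>lborel)"
  proof (rule Bochner_Integration.integral_cong[OF refl])
    fix k
    let ?p = "Complex \<gamma> k"
    have h_k: "h (w, k) = stable_mgf c \<alpha> ?p * (exp (of_real y * ?p) / ?p * of_real u) *
        (indicator {0<..} w *\<^sub>R exp (- (?p - of_real u) * of_real w))" for w
    proof -
      have "of_real (exp (u * w)) * exp (- of_real (w - y) * ?p) = exp (of_real y * ?p) * exp (- (?p - of_real u) * of_real w)"
        unfolding exp_of_real[symmetric] exp_add[symmetric] by (simp add: algebra_simps)
      then show ?thesis by (simp add: h_def field_simps scaleR_conv_of_real)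
    qed
    have "(\<integral>w. h (w, k) \<partial>lborel) = stable_mgf c \<alpha> ?p * (exp (of_real y * ?p) / ?p * of_real u) *
        (\<integral>w\<in>{0<..}. exp (- (?p - of_real u) * of_real w) \<partial>lborel)"
      unfolding h_k set_lebesgue_integral_def by (rule integral_mult_right_zero)
    also have "(\<integral>w\<in>{0<..}. exp (- (?p - of_real u) * of_real w) \<partial>lborel) = 1 / (?p - of_real u)"
      using u by (intro exp_set_integral) simp
    finally show "(\<integral>w. h (w, k) \<partial>lborel) = stable_mgf c \<alpha> ?p * (exp (of_real y * ?p) / ?p * (of_real u / (?p - of_real u)))"
      by simp
  qed
  finally show "(\<integral>w\<in>{0<..}. of_real (u * exp (u * w)) * tail (w - y) \<partial>lborel) =
       (\<integral>k. stable_mgf c \<alpha> (Complex \<gamma> k) * (exp (of_real y * Complex \<gamma> k) / Complex \<gamma> k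
          * (of_real u / (Complex \<gamma> k - of_real u))) \<partial>lborel) / of_real (2 * pi)"
    by (simp add: field_simps)
qed

lemma norm_line_minus_ge: "\<gamma> - u \<le> norm (Complex \<gamma> k - of_real u)"
  using abs_Re_le_cmod[of "Complex \<gamma> k - of_real u"] by simp

lemma line_minus_nonzero: "u < \<gamma> \<Longrightarrow> Complex \<gamma> k - of_real u \<noteq> 0"
  using norm_line_minus_ge[of u k] by auto

section \<open>Termwise integration of the two expansions\<close>

lemma resolvent_integrable:
  assumes "u < \<gamma>" and [measurable]: "G \<in> borel_measurable borel"
    and G: "\<And>k. norm (G k) \<le> B * exp (A * norm (Complex \<gamma> k))"
  shows "integrable lborel (\<lambda>k. stable_mgf c \<alpha> (Complex \<gamma> k) * (G k / (Complex \<gamma> k - of_real u)))"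
proof (rule stable_line_integrable)
  fix k
  have "norm (G k / (Complex \<gamma> k - of_real u)) \<le> (B * exp (A * norm (Complex \<gamma> k))) / (\<gamma> - u)"
    unfolding norm_divide using assms norm_line_minus_ge[of u k] by (intro frac_le order_trans[OF norm_ge_zero G] G) auto
  then show "norm (G k / (Complex \<gamma> k - of_real u)) \<le> (B / (\<gamma> - u)) * exp (A * norm (Complex \<gamma> k))"
    by simp
qed measurable

text \<open>1/(p - u) is the geometric series of u^m / p^(m+1), whose ratio is at most u/\<gamma> <
  1 in modulus on the whole line. The integrals of the norms therefore have a geometric
  majorant.\<close>

lemma resolvent_expansion:
  assumes u: "0 < u" "u < \<gamma>" and [measurable]: "G \<in> borel_measurable borel"
    and G: "\<And>k. norm (G k) \<le> B * exp (A * norm (Complex \<gamma> k))"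
  shows "(\<lambda>m. \<integral>k. stable_mgf c \<alpha> (Complex \<gamma> k) * (G k * (of_real u ^ m / Complex \<gamma> k ^ Suc m)) \<partial>lborel)
     sums (\<integral>k. stable_mgf c \<alpha> (Complex \<gamma> k) * (G k / (Complex \<gamma> k - of_real u)) \<partial>lborel)"
proof -
  define f where "f m k = stable_mgf c \<alpha> (Complex \<gamma> k) * (G k * (of_real u ^ m / Complex \<gamma> k ^ Suc m))" for m k
  define I where "I = (\<integral>k. norm (stable_mgf c \<alpha> (Complex \<gamma> k) * G k) \<partial>lborel)"
  have EG: "integrable lborel (\<lambda>k. norm (stable_mgf c \<alpha> (Complex \<gamma> k) * G k))"
    by (intro integrable_norm stable_line_integrable[OF _ G]) measurable
  have f_le: "norm (f m k) \<le> norm (stable_mgf c \<alpha> (Complex \<gamma> k) * G k) * ((u / \<gamma>) ^ m / \<gamma>)" for m k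
  proof -
    have "norm (of_real u ^ m / Complex \<gamma> k ^ Suc m) \<le> u ^ m / \<gamma> ^ Suc m"
      unfolding norm_divide norm_power using u \<gamma> \<gamma>_le_norm_line(1)[of k]
      by (intro frac_le power_mono) auto
    also have "\<dots> = (u / \<gamma>) ^ m / \<gamma>" by (simp add: power_divide)
    finally show ?thesis unfolding f_def mult.assoc[symmetric] norm_mult[of _ "of_real u ^ m / _"]
      by (rule mult_left_mono) simp
  qed
  have f_int: "integrable lborel (f m)" for m
  proof (rule Bochner_Integration.integrable_bound)
    show "integrable lborel (\<lambda>k. norm (stable_mgf c \<alpha> (Complex \<gamma> k) * G k) * ((u / \<gamma>) ^ m / \<gamma>))"
      using EG by (rule integrable_mult_left)
    show "f m \<in> borel_measurable lborel" unfolding f_def[abs_def] by measurable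
    show "AE k in lborel. norm (f m k) \<le> norm (norm (stable_mgf c \<alpha> (Complex \<gamma> k) * G k) * ((u / \<gamma>) ^ m / \<gamma>))"
      unfolding real_norm_def by (intro AE_I2 order_trans[OF f_le abs_ge_self])
  qed
  have geo: "summable (\<lambda>m. C * ((u / \<gamma>) ^ m / \<gamma>))" for C :: real
    using u \<gamma> by (intro summable_mult summable_divide summable_geometric) auto
  have f_sums: "(\<lambda>m. f m k) sums (stable_mgf c \<alpha> (Complex \<gamma> k) * (G k / (Complex \<gamma> k - of_real u)))" for k
  proof -
    let ?p = "Complex \<gamma> k"
    have "norm (of_real u / ?p) < 1"
      using u \<gamma>_le_norm_line(1)[of k] by (simp add: norm_divide)
    then have "(\<lambda>m. (of_real u / ?p) ^ m) sums (1 / (1 - of_real u / ?p))" by (rule geometric_sums)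
    then have sums: "(\<lambda>m. stable_mgf c \<alpha> ?p * G k / ?p * (of_real u / ?p) ^ m)
        sums (stable_mgf c \<alpha> ?p * G k / ?p * (1 / (1 - of_real u / ?p)))" by (rule sums_mult)
    have eq1: "stable_mgf c \<alpha> ?p * G k / ?p * (of_real u / ?p) ^ m = f m k" for m
      by (simp add: f_def power_divide)
    have eq2: "stable_mgf c \<alpha> ?p * G k / ?p * (1 / (1 - of_real u / ?p)) = stable_mgf c \<alpha> ?p * (G k / (?p - of_real u))"
    proof -
      have "1 - of_real u / ?p = (?p - of_real u) / ?p" by (simp add: diff_divide_distrib)
      then show ?thesis by simp
    qed
    show ?thesis using sums unfolding eq1 eq2 .
  qed
  have "(\<lambda>m. integral\<^sup>L lborel (f m)) sums (\<integral>k. (\<Sum>m. f m k) \<partial>lborel)"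
  proof (rule sums_integral[OF f_int])
    show "AE k in lborel. summable (\<lambda>m. norm (f m k))"
      by (intro AE_I2 summable_comparison_test'[OF geo]) (use f_le in auto)
    show "summable (\<lambda>m. \<integral>k. norm (f m k) \<partial>lborel)"
    proof (rule summable_comparison_test'[OF geo])
      fix m :: nat
      have "(\<integral>k. norm (f m k) \<partial>lborel) \<le> (\<integral>k. norm (stable_mgf c \<alpha> (Complex \<gamma> k) * G k) * ((u / \<gamma>) ^ m / \<gamma>) \<partial>lborel)"
        by (intro integral_mono integrable_norm f_int integrable_mult_left EG f_le)
      also have "\<dots> = I * ((u / \<gamma>) ^ m / \<gamma>)" unfolding I_def by (rule integral_mult_left_zero)
      finally show "norm (\<integral>k. norm (f m k) \<partial>lborel) \<le> I * ((u / \<gamma>) ^ m / \<gamma>)" by simp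
    qed
  qed
  then show ?thesis unfolding f_def[symmetric] using sums_unique[OF f_sums] by simp
qed

lemma power_line_bound:
  "norm ((of_real y * Complex \<gamma> k) ^ n / fact n) \<le> 1 * exp (\<bar>y\<bar> * norm (Complex \<gamma> k))"
  using power_div_fact_le_exp[of "\<bar>y\<bar> * norm (Complex \<gamma> k)" n] by (simp add: norm_divide norm_power norm_mult)

text \<open>Replacing each term by its norm replaces e^(y p) by e^(|y| |p|), which the decay of the
  transform still absorbs; this justifies exchanging sum and integral.\<close>

lemma exp_expansion:
  assumes u: "u < \<gamma>"
  shows "(\<lambda>n. \<integral>k. stable_mgf c \<alpha> (Complex \<gamma> k) * ((of_real y * Complex \<gamma> k) ^ n / fact n / (Complex \<gamma> k - of_real u)) \<partial>lborel)
     sums (\<integral>k. stable_mgf c \<alpha> (Complex \<gamma> k) * (exp (of_real y * Complex \<gamma> k) / (Complex \<gamma> k - of_real u)) \<partial>lborel)"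
proof -
  define f where "f n k = stable_mgf c \<alpha> (Complex \<gamma> k) * ((of_real y * Complex \<gamma> k) ^ n / fact n / (Complex \<gamma> k - of_real u))" for n k
  \<comment> \<open>Its norm is exactly the sum of the norms of the \<open>f n\<close>, so it bounds
    all their partial sums. Keeping the denominator p - u lets the same integrability lemma cover
    it.\<close>
  define g where "g k = stable_mgf c \<alpha> (Complex \<gamma> k) * (of_real (exp (\<bar>y\<bar> * norm (Complex \<gamma> k))) / (Complex \<gamma> k - of_real u))" for k
  have f_int: "integrable lborel (f n)" for n
    unfolding f_def[abs_def] by (rule resolvent_integrable[OF u _ power_line_bound]) measurable
  have g_int: "integrable lborel (\<lambda>k. norm (g k))"
    unfolding g_def[abs_def]
  proof (rule integrable_norm, rule resolvent_integrable[OF u])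
    show "norm (complex_of_real (exp (\<bar>y\<bar> * norm (Complex \<gamma> k)))) \<le> 1 * exp (\<bar>y\<bar> * norm (Complex \<gamma> k))" for k
      by simp
  qed measurable
  have norm_sums: "(\<lambda>n. norm (f n k)) sums norm (g k)" for k
  proof -
    have "(\<lambda>n. (\<bar>y\<bar> * norm (Complex \<gamma> k)) ^ n / fact n) sums exp (\<bar>y\<bar> * norm (Complex \<gamma> k))"
      using exp_converges[of "\<bar>y\<bar> * norm (Complex \<gamma> k)"] by (simp add: divide_inverse mult.commute)
    then have "(\<lambda>n. norm (stable_mgf c \<alpha> (Complex \<gamma> k)) * ((\<bar>y\<bar> * norm (Complex \<gamma> k)) ^ n / fact n / norm (Complex \<gamma> k - of_real u)))
       sums (norm (stable_mgf c \<alpha> (Complex \<gamma> k)) * (exp (\<bar>y\<bar> * norm (Complex \<gamma> k)) / norm (Complex \<gamma> k - of_real u)))"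
      by (intro sums_mult sums_divide)
    then show ?thesis by (simp add: f_def g_def norm_mult norm_divide norm_power)
  qed
  have f_sums: "(\<lambda>n. f n k) sums (stable_mgf c \<alpha> (Complex \<gamma> k) * (exp (of_real y * Complex \<gamma> k) / (Complex \<gamma> k - of_real u)))" for k
  proof -
    have "(\<lambda>n. (of_real y * Complex \<gamma> k) ^ n / fact n) sums exp (of_real y * Complex \<gamma> k)"
      using exp_converges[of "of_real y * Complex \<gamma> k"] by (simp add: scaleR_conv_of_real divide_inverse mult.commute)
    then show ?thesis unfolding f_def by (intro sums_mult sums_divide)
  qed
  have "(\<lambda>n. integral\<^sup>L lborel (f n)) sums (\<integral>k. (\<Sum>n. f n k) \<partial>lborel)"
  proof (rule sums_integral[OF f_int])
    show "AE k in lborel. summable (\<lambda>n. norm (f n k))" using norm_sums by (intro AE_I2 sums_summable)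
    show "summable (\<lambda>n. \<integral>k. norm (f n k) \<partial>lborel)"
    proof (rule summableI_nonneg_bounded)
      fix N
      have "(\<Sum>n<N. \<integral>k. norm (f n k) \<partial>lborel) = (\<integral>k. (\<Sum>n<N. norm (f n k)) \<partial>lborel)"
        by (intro Bochner_Integration.integral_sum[symmetric] integrable_norm f_int)
      also have "\<dots> \<le> (\<integral>k. norm (g k) \<partial>lborel)"
      proof (rule integral_mono[OF _ g_int])
        show "integrable lborel (\<lambda>k. \<Sum>n<N. norm (f n k))"
          by (intro Bochner_Integration.integrable_sum integrable_norm f_int)
      next
        fix k
        show "(\<Sum>n<N. norm (f n k)) \<le> norm (g k)"
          using sum_le_suminf[OF sums_summable[OF norm_sums[of k]], of "{..<N}"] sums_unique[OF norm_sums[of k]] by simp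
      qed
      finally show "(\<Sum>n<N. \<integral>k. norm (f n k) \<partial>lborel) \<le> (\<integral>k. norm (g k) \<partial>lborel)" .
    qed simp
  qed
  then show ?thesis unfolding f_def[symmetric] using sums_unique[OF f_sums] by simp
qed

text \<open>The expansions are nested: for each n the resolvent is expanded in m, and the resulting
  integrals are then summed over n. This gives the iterated order of summation. The factor
  \<alpha>/(2 pi) undoes the constant in \<open>hankel_eq\<close>.\<close>

proposition double_series:
  fixes u y :: real
  assumes u: "0 < u" "u < \<gamma>"
  defines "a \<equiv> \<lambda>n m. rGamma (1 + (real m - real n) / \<alpha>) / fact n * u ^ m * y ^ n * c powr ((real m - real n) / \<alpha>)"
  shows "summable (a n)" "summable (\<lambda>n. \<Sum>m. a n m)"
    "of_real (\<Sum>n. \<Sum>m. a n m) = of_real (\<alpha> / (2 * pi)) *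
       (\<integral>k. stable_mgf c \<alpha> (Complex \<gamma> k) * (exp (of_real y * Complex \<gamma> k) / (Complex \<gamma> k - of_real u)) \<partial>lborel)"
proof -
  define J where "J n = (\<integral>k. stable_mgf c \<alpha> (Complex \<gamma> k) * ((of_real y * Complex \<gamma> k) ^ n / fact n / (Complex \<gamma> k - of_real u)) \<partial>lborel)" for n
  have term_eq: "(\<integral>k. stable_mgf c \<alpha> (Complex \<gamma> k) * ((of_real y * Complex \<gamma> k) ^ n / fact n * (of_real u ^ m / Complex \<gamma> k ^ Suc m)) \<partial>lborel)
      = of_real (2 * pi / \<alpha> * a n m)" for n m
  proof -
    \<comment> \<open>The shift by 1 comes from p^(m+1) in the resolvent series; it makes (s -
      1)/\<alpha> equal to (m - n)/\<alpha>.\<close>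
    define s where "s = real m + 1 - real n"
    have p: "Complex \<gamma> k ^ n / Complex \<gamma> k ^ Suc m = Complex \<gamma> k powr of_real (- s)" for k
    proof -
      have "of_real (- s) = (of_nat n - of_nat (Suc m) :: complex)" by (simp add: s_def)
      then show ?thesis by (simp only: powr_diff powr_nat' line_nonzero simp_thms)
    qed
    have "stable_mgf c \<alpha> (Complex \<gamma> k) * ((of_real y * Complex \<gamma> k) ^ n / fact n * (of_real u ^ m / Complex \<gamma> k ^ Suc m))
        = of_real (y ^ n / fact n * u ^ m) * (stable_mgf c \<alpha> (Complex \<gamma> k) * Complex \<gamma> k powr of_real (- s))" for k
      unfolding p[symmetric] by (simp add: power_mult_distrib)
    then have "(\<integral>k. stable_mgf c \<alpha> (Complex \<gamma> k) * ((of_real y * Complex \<gamma> k) ^ n / fact n * (of_real u ^ m / Complex \<gamma> k ^ Suc m)) \<partial>lborel)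
        = of_real (y ^ n / fact n * u ^ m) * hankel s"
      unfolding hankel_def by simp
    also have "\<dots> = of_real (y ^ n / fact n * u ^ m * (2 * pi / \<alpha> * c powr ((s - 1) / \<alpha>) * rGamma (1 + (s - 1) / \<alpha>)))"
      unfolding hankel_eq by simp
    also have "s - 1 = real m - real n" by (simp add: s_def)
    finally show ?thesis by (simp add: a_def mult_ac)
  qed
  have inner: "(\<lambda>m. of_real (2 * pi / \<alpha> * a n m)) sums J n" for n
    unfolding J_def term_eq[symmetric] by (rule resolvent_expansion[OF u _ power_line_bound]) measurable
  have inner': "(\<lambda>m. of_real (a n m)) sums (of_real (\<alpha> / (2 * pi)) * J n)" for n
    using sums_mult[OF inner[of n], of "of_real (\<alpha> / (2 * pi))"] \<alpha> by simp
  have sm: "summable (a n)" for n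
    using sums_summable[OF inner'[of n]] by (simp only: summable_of_real_iff)
  then show "summable (a n)" .
  have J: "of_real (\<Sum>m. a n m) = of_real (\<alpha> / (2 * pi)) * J n" for n
    by (rule sums_unique2[OF sums_of_real[OF summable_sums[OF sm]] inner'])
  have outer: "(\<lambda>n. of_real (\<Sum>m. a n m)) sums (of_real (\<alpha> / (2 * pi)) *
      (\<integral>k. stable_mgf c \<alpha> (Complex \<gamma> k) * (exp (of_real y * Complex \<gamma> k) / (Complex \<gamma> k - of_real u)) \<partial>lborel))"
    unfolding J unfolding J_def by (intro sums_mult exp_expansion u)
  show sm2: "summable (\<lambda>n. \<Sum>m. a n m)"
    using sums_summable[OF outer] by (simp only: summable_of_real_iff)
  show "of_real (\<Sum>n. \<Sum>m. a n m) = of_real (\<alpha> / (2 * pi)) *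
       (\<integral>k. stable_mgf c \<alpha> (Complex \<gamma> k) * (exp (of_real y * Complex \<gamma> k) / (Complex \<gamma> k - of_real u)) \<partial>lborel)"
    by (rule sums_unique2[OF sums_of_real[OF summable_sums[OF sm2]] outer])
qed

end

section \<open>Expectation of the exponential payoff\<close>

context stable_distribution
begin

text \<open>Integrability is obtained, not presupposed: everything is nonnegative, so Tonelli
  expresses the expectation through tail probabilities, and the contour representation shows the
  result to be finite. The boundary term P(X > -y) and the integrated tail then merge into a single
  kernel.\<close>

lemma exponential_payoff:
  fixes u y :: real
  assumes u: "0 < u" "u < \<gamma>"
  defines "P \<equiv> \<lambda>x. if x + y > 0 then exp (u * (x + y)) else 0"
  shows "integrable M P"
    "of_real (\<integral>x. P x \<partial>M) =
       (\<integral>k. stable_mgf c \<alpha> (Complex \<gamma> k) * (exp (of_real y * Complex \<gamma> k) / (Complex \<gamma> k - of_real u)) \<partial>lborel) / of_real (2 * pi)"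
proof -
  interpret P: pair_sigma_finite M lborel ..
  define f where "f x w = ennreal (u * exp (u * w)) * indicator {0<..} w * indicator {0<..} (x + y - w)" for x w :: real
  have f_meas [measurable]: "case_prod f \<in> borel_measurable (M \<Otimes>\<^sub>M lborel)"
    unfolding f_def case_prod_beta by measurable
  have P_meas [measurable]: "P \<in> borel_measurable M" unfolding P_def by measurable
  \<comment> \<open>For v = x + y > 0, e^(u v) is 1 plus the integral of u e^(u w) over 0 < w < v.
    The 1 is the jump of the payoff at the exercise boundary.\<close>
  have layer: "ennreal (P x) = indicator {- y<..} x + (\<integral>\<^sup>+w. f x w \<partial>lborel)" for x
  proof (cases "x + y > 0")
    case True
    have "(\<integral>\<^sup>+w. f x w \<partial>lborel) = (\<integral>\<^sup>+w. ennreal (u * exp (u * w)) * indicator {0..x + y} w \<partial>lborel)"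
    proof (rule nn_integral_cong_AE)
      show "AE w in lborel. f x w = ennreal (u * exp (u * w)) * indicator {0..x + y} w"
        using AE_lborel_singleton[of 0] AE_lborel_singleton[of "x + y"]
        by eventually_elim (auto simp: f_def split: split_indicator)
    qed
    also have "\<dots> = ennreal (exp (u * (x + y)) - exp (u * 0))"
      using True u by (intro nn_integral_FTC_Icc) (auto intro!: derivative_eq_intros)
    finally have "indicator {- y<..} x + (\<integral>\<^sup>+w. f x w \<partial>lborel) = 1 + ennreal (exp (u * (x + y)) - 1)"
      using True by simp
    also have "\<dots> = ennreal (1 + (exp (u * (x + y)) - 1))"
      using True u by (subst ennreal_plus) auto
    finally show ?thesis using True by (simp add: P_def)
  next
    case False
    then have "f x w = 0" for w by (auto simp: f_def split: split_indicator)
    then show ?thesis using False by (simp add: P_def)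
  qed
  define T where "T w = measure M {w - y<..}" for w
  have T_tail: "of_real (T w) = tail (w - y)" for w by (simp add: T_def tail_eq)
  \<comment> \<open>The tail is real, so the complex integrability obtained from the contour
    representation transfers to the real integrand.\<close>
  have T_int: "set_integrable lborel {0<..} (\<lambda>w. u * exp (u * w) * T w)"
  proof -
    have "integrable lborel (\<lambda>w. complex_of_real (indicator {0<..} w *\<^sub>R (u * exp (u * w) * T w)))"
      using tail_laplace(1)[OF u, of y] unfolding set_integrable_def T_tail[symmetric] by (simp add: scaleR_conv_of_real)
    then show ?thesis unfolding set_integrable_def complex_of_real_integrable_eq .
  qed
  let ?I = "\<integral>w\<in>{0<..}. u * exp (u * w) * T w \<partial>lborel"
  have "(\<integral>\<^sup>+x. ennreal (P x) \<partial>M) = emeasure M {- y<..} + (\<integral>\<^sup>+x. \<integral>\<^sup>+w. f x w \<partial>lborel \<partial>M)"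
    unfolding layer by (subst nn_integral_add) (auto intro: lborel.borel_measurable_nn_integral)
  also have "(\<integral>\<^sup>+x. \<integral>\<^sup>+w. f x w \<partial>lborel \<partial>M) = (\<integral>\<^sup>+w. \<integral>\<^sup>+x. f x w \<partial>M \<partial>lborel)"
    by (rule P.Fubini'[symmetric]) measurable
  also have "\<dots> = (\<integral>\<^sup>+w. ennreal (indicator {0<..} w *\<^sub>R (u * exp (u * w) * T w)) \<partial>lborel)"
  proof (rule nn_integral_cong)
    fix w :: real
    have "(\<integral>\<^sup>+x. f x w \<partial>M) = (\<integral>\<^sup>+x. (ennreal (u * exp (u * w)) * indicator {0<..} w) * indicator {w - y<..} x \<partial>M)"
      unfolding f_def by (intro nn_integral_cong) (auto split: split_indicator)
    also have "\<dots> = (ennreal (u * exp (u * w)) * indicator {0<..} w) * emeasure M {w - y<..}"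
      by (rule nn_integral_cmult_indicator) simp
    also have "\<dots> = ennreal (indicator {0<..} w *\<^sub>R (u * exp (u * w) * T w))"
      using u by (auto simp: emeasure_eq_measure T_def ennreal_mult split: split_indicator)
    finally show "(\<integral>\<^sup>+x. f x w \<partial>M) = ennreal (indicator {0<..} w *\<^sub>R (u * exp (u * w) * T w))" .
  qed
  also have "\<dots> = ennreal ?I"
    using T_int u unfolding set_integrable_def set_lebesgue_integral_def
    by (intro nn_integral_eq_integral) (auto simp: T_def split: split_indicator)
  also have "emeasure M {- y<..} = ennreal (T 0)" by (simp add: T_def emeasure_eq_measure)
  also have "ennreal (T 0) + ennreal ?I = ennreal (T 0 + ?I)"
    using u by (intro ennreal_plus[symmetric])
      (auto simp: T_def set_lebesgue_integral_def intro!: integral_nonneg_AE split: split_indicator)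
  finally have nn: "(\<integral>\<^sup>+x. ennreal (P x) \<partial>M) = ennreal (T 0 + ?I)" .
  have P_nonneg: "P x \<ge> 0" for x by (simp add: P_def)
  show "integrable M P"
    by (rule integrableI_nonneg) (use nn P_nonneg in auto)
  have I_nonneg: "T 0 + ?I \<ge> 0"
    using u by (intro add_nonneg_nonneg)
      (auto simp: T_def set_lebesgue_integral_def intro!: integral_nonneg_AE split: split_indicator)
  have "(\<integral>x. P x \<partial>M) = T 0 + ?I"
    by (subst integral_eq_nn_integral) (use nn P_nonneg I_nonneg in auto)
  then have "of_real (\<integral>x. P x \<partial>M) = tail (- y) + (\<integral>w\<in>{0<..}. of_real (u * exp (u * w)) * tail (w - y) \<partial>lborel)"
    unfolding T_tail[symmetric] of_real_mult[symmetric] set_integral_complex_of_real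
    using T_tail[of 0] by simp
  also have "\<dots> = ((\<integral>k. stable_mgf c \<alpha> (Complex \<gamma> k) * (exp (of_real y * Complex \<gamma> k) / Complex \<gamma> k) \<partial>lborel)
     + (\<integral>k. stable_mgf c \<alpha> (Complex \<gamma> k) * (exp (of_real y * Complex \<gamma> k) / Complex \<gamma> k
          * (of_real u / (Complex \<gamma> k - of_real u))) \<partial>lborel)) / of_real (2 * pi)"
    unfolding tail_laplace(2)[OF u] by (simp add: tail_def add_divide_distrib)
  also have "(\<integral>k. stable_mgf c \<alpha> (Complex \<gamma> k) * (exp (of_real y * Complex \<gamma> k) / Complex \<gamma> k) \<partial>lborel)
     + (\<integral>k. stable_mgf c \<alpha> (Complex \<gamma> k) * (exp (of_real y * Complex \<gamma> k) / Complex \<gamma> k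
          * (of_real u / (Complex \<gamma> k - of_real u))) \<partial>lborel)
     = (\<integral>k. stable_mgf c \<alpha> (Complex \<gamma> k) * (exp (of_real y * Complex \<gamma> k) / (Complex \<gamma> k - of_real u)) \<partial>lborel)"
  proof (subst Bochner_Integration.integral_add[symmetric])
    show "integrable lborel (\<lambda>k. stable_mgf c \<alpha> (Complex \<gamma> k) * (exp (of_real y * Complex \<gamma> k) / Complex \<gamma> k))"
      using tail_integrable[of "- y"] by simp
    have "integrable lborel (\<lambda>k. stable_mgf c \<alpha> (Complex \<gamma> k) * ((exp (of_real y * Complex \<gamma> k) / Complex \<gamma> k * of_real u) / (Complex \<gamma> k - of_real u)))"
    proof (rule resolvent_integrable[where A = 0])
      show "norm (exp (of_real y * Complex \<gamma> k) / Complex \<gamma> k * of_real u) \<le> (exp (y * \<gamma>) / \<gamma> * u) * exp (0 * norm (Complex \<gamma> k))" for k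
        using tail_kernel_bound[of "- y" k] u by (simp add: norm_mult mult_right_mono del: times_divide_eq_left)
    qed (use u in measurable)
    then show "integrable lborel (\<lambda>k. stable_mgf c \<alpha> (Complex \<gamma> k) * (exp (of_real y * Complex \<gamma> k) / Complex \<gamma> k * (of_real u / (Complex \<gamma> k - of_real u))))"
      by simp
    have "exp (of_real y * Complex \<gamma> k) / Complex \<gamma> k + exp (of_real y * Complex \<gamma> k) / Complex \<gamma> k * (of_real u / (Complex \<gamma> k - of_real u))
       = exp (of_real y * Complex \<gamma> k) / (Complex \<gamma> k - of_real u)" for k
    proof -
      \<comment> \<open>The merging identity 1/p + (1/p) u/(p - u) = 1/(p - u): the pole at 0
        disappears and only the one at u remains.\<close>
      have "e / p + e / p * (v / (p - v)) = e / (p - v)" if "p \<noteq> 0" "p - v \<noteq> 0" for e p v :: complex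
        using that by (simp add: divide_simps) (simp add: algebra_simps)
      then show ?thesis using line_minus_nonzero[OF u(2), of k] line_nonzero[of k] by blast
    qed
    then show "(\<integral>k. stable_mgf c \<alpha> (Complex \<gamma> k) * (exp (of_real y * Complex \<gamma> k) / Complex \<gamma> k)
       + stable_mgf c \<alpha> (Complex \<gamma> k) * (exp (of_real y * Complex \<gamma> k) / Complex \<gamma> k * (of_real u / (Complex \<gamma> k - of_real u))) \<partial>lborel)
     = (\<integral>k. stable_mgf c \<alpha> (Complex \<gamma> k) * (exp (of_real y * Complex \<gamma> k) / (Complex \<gamma> k - of_real u)) \<partial>lborel)"
      unfolding distrib_left[symmetric] by simp
  qed
  finally show "of_real (\<integral>x. P x \<partial>M) =
       (\<integral>k. stable_mgf c \<alpha> (Complex \<gamma> k) * (exp (of_real y * Complex \<gamma> k) / (Complex \<gamma> k - of_real u)) \<partial>lborel) / of_real (2 * pi)" .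
qed

end

subsection \<open>The option value\<close>

text \<open>On the principal branch the logarithm of i k is ln |k| + i sgn(k) pi/2; the sign
  survives only in the sine.\<close>

lemma imaginary_powr:
  assumes "k \<noteq> 0"
  shows "(\<i> * of_real k) powr of_real \<alpha> =
    of_real (\<bar>k\<bar> powr \<alpha>) * (of_real (cos (\<alpha> * pi / 2)) + \<i> * of_real (sin (\<alpha> * pi / 2) * sgn k))"
proof -
  have "Ln (\<i> * of_real k) = of_real (ln \<bar>k\<bar>) + \<i> * of_real (sgn k * pi / 2)"
    using assms by (simp add: complex_eq_iff Im_Ln_eq norm_mult sgn_if)
  then have "(\<i> * of_real k) powr of_real \<alpha> = exp (of_real \<alpha> * (of_real (ln \<bar>k\<bar>) + \<i> * of_real (sgn k * pi / 2)))"
    using assms by (simp add: powr_def)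
  also have "\<dots> = exp (of_real (\<alpha> * ln \<bar>k\<bar>)) * cis (sgn k * (\<alpha> * pi / 2))"
    unfolding cis_conv_exp exp_add[symmetric] by (simp add: algebra_simps)
  also have "cis (sgn k * (\<alpha> * pi / 2)) = of_real (cos (\<alpha> * pi / 2)) + \<i> * of_real (sin (\<alpha> * pi / 2) * sgn k)"
    using assms by (simp add: complex_eq_iff sgn_if)
  also have "exp (of_real (\<alpha> * ln \<bar>k\<bar>)) = (of_real (\<bar>k\<bar> powr \<alpha>) :: complex)"
    using assms unfolding exp_of_real by (simp add: powr_def)
  finally show ?thesis .
qed

text \<open>Dividing by cos(pi \<alpha> / 2) in \<mu> is what absorbs the tangent: c cos is -\<tau>
  \<sigma>^\<alpha>, and c sin is the same times the tangent. Thus the skewness -1 is precisely the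
  case in which the characteristic exponent is a single power c (i k)^\<alpha>.\<close>

lemma stable_char_eq_mgf:
  fixes \<alpha> \<sigma> \<tau> k :: real
  assumes \<alpha>: "1 < \<alpha>" "\<alpha> \<le> 2"
  defines "c \<equiv> - (\<sigma> powr \<alpha> / cos (pi * \<alpha> / 2) * \<tau>)"
  shows "exp (- complex_of_real (\<tau> * \<sigma> powr \<alpha> * \<bar>k\<bar> powr \<alpha>)
           * (1 + \<i> * complex_of_real (tan (\<alpha> * pi / 2) * sgn k))) = stable_mgf c \<alpha> (\<i> * of_real k)"
proof (cases "k = 0")
  case False
  \<comment> \<open>The angle lies in (pi/2, pi], so the division in c is legitimate.\<close>
  have "cos (\<alpha> * pi / 2) < 0" using \<alpha> pi_gt_zero by (intro cos_lt_zero_pi) auto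
  then have "c * cos (\<alpha> * pi / 2) = - (\<tau> * \<sigma> powr \<alpha>)"
    "c * sin (\<alpha> * pi / 2) = - (\<tau> * \<sigma> powr \<alpha>) * tan (\<alpha> * pi / 2)"
    by (auto simp: c_def tan_def mult.commute)
  then have "complex_of_real (\<bar>k\<bar> powr \<alpha>) * (of_real (c * cos (\<alpha> * pi / 2)) + \<i> * of_real (c * sin (\<alpha> * pi / 2) * sgn k))
      = - complex_of_real (\<tau> * \<sigma> powr \<alpha> * \<bar>k\<bar> powr \<alpha>) * (1 + \<i> * complex_of_real (tan (\<alpha> * pi / 2) * sgn k))"
    by (simp add: algebra_simps)
  moreover have "of_real c * (\<i> * of_real k) powr of_real \<alpha>
      = of_real (\<bar>k\<bar> powr \<alpha>) * (of_real (c * cos (\<alpha> * pi / 2)) + \<i> * of_real (c * sin (\<alpha> * pi / 2) * sgn k))"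
    unfolding imaginary_powr[OF False] by (simp only: of_real_mult distrib_left mult_ac)
  ultimately show ?thesis unfolding stable_mgf_def by (simp only:)
qed (simp add: stable_mgf_def)

text \<open>The shift y is chosen so that S_T^u = K e^(u (x + y)). The exercise condition then reads
  x + y > 0, and the strike K factors out.\<close>

lemma power_asset_or_nothing_call_eq:
  fixes u S K r \<mu> \<tau> x :: real
  assumes "u > 0" "S > 0" "K > 0"
  defines "y \<equiv> ln (S / K powr (1 / u)) + r * \<tau> + \<mu> * \<tau>"
  shows "power_asset_or_nothing_call u (S * exp ((r + \<mu>) * \<tau> + x)) K
           = K * (if x + y > 0 then exp (u * (x + y)) else 0)"
proof -
  have "ln (S / K powr (1 / u)) = ln S - ln K / u" using assms by (simp add: ln_div ln_powr)
  then have "u * (x + y) = u * (ln S + ((r + \<mu>) * \<tau> + x)) - ln K"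
    using assms by (simp add: y_def field_simps)
  then have "K * exp (u * (x + y)) = exp (u * (ln S + ((r + \<mu>) * \<tau> + x)))"
    using assms by (simp add: exp_diff)
  also have "\<dots> = (S * exp ((r + \<mu>) * \<tau> + x)) powr u"
    using assms by (simp add: powr_def ln_mult)
  finally have *: "(S * exp ((r + \<mu>) * \<tau> + x)) powr u = K * exp (u * (x + y))" ..
  have "K * exp (u * (x + y)) - K > 0 \<longleftrightarrow> exp (u * (x + y)) > 1"
    using assms by simp
  also have "\<dots> \<longleftrightarrow> x + y > 0" using assms by (simp add: zero_less_mult_iff)
  finally show ?thesis unfolding power_asset_or_nothing_call_def * by simp
qed

text \<open>\<open>rGamma\<close> is the reciprocal Gamma function, zero at the poles of Gamma as
  the convention requires. Integrability of the payoff and summability of the inner and outer series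
  are part of the conclusion because the integral and the infinite sums would otherwise carry no
  information.\<close>

theorem proposition5:
  fixes M :: "'a measure" and X :: "real \<Rightarrow> 'a \<Rightarrow> real"
    and \<alpha> \<sigma> u S K r \<tau> \<mu> k\<^sub>u :: real
  assumes "1 < \<alpha>" "\<alpha> \<le> 2" "\<sigma> > 0" "u > 0" "S > 0" "K > 0" "\<tau> > 0"
    and "spectrally_negative_stable_process M X \<alpha> \<sigma>"
    and "\<mu> = \<sigma> powr \<alpha> / cos (pi * \<alpha> / 2)"
    and "k\<^sub>u = ln (S / K powr (1 / u)) + r * \<tau>"
  shows
    "let a = (\<lambda>n m. rGamma (1 + (real m - real n) / \<alpha>) / fact n
                 * u ^ m * (k\<^sub>u + \<mu> * \<tau>) ^ n * (- \<mu> * \<tau>) powr ((real m - real n) / \<alpha>))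
     in integrable M (\<lambda>\<omega>. power_asset_or_nothing_call u (asset_price X S r \<mu> \<tau> \<omega>) K) \<and>
        (\<forall>n. summable (\<lambda>m. a n m)) \<and> summable (\<lambda>n. \<Sum>m. a n m) \<and>
        option_value M X (power_asset_or_nothing_call u) S K r \<mu> \<tau>
          = K * exp (- r * \<tau>) / \<alpha> * (\<Sum>n. \<Sum>m. a n m)"
proof -
  \<comment> \<open>Any abscissa beyond u would serve; the value of the option does not depend on
    \<gamma>.\<close>
  define c y \<gamma> where "c = - \<mu> * \<tau>" and "y = k\<^sub>u + \<mu> * \<tau>" and "\<gamma> = u + 1"
  interpret X: spectrally_negative_stable_process M X \<alpha> \<sigma> by fact
  define N where "N = distr M borel (X \<tau>)"
  have X_meas [measurable]: "X \<tau> \<in> borel_measurable M" using X.measurable_X assms(7) by simp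
  have "cos (pi * \<alpha> / 2) < 0" using assms(1,2) pi_gt_zero by (intro cos_lt_zero_pi) auto
  then have c: "c > 0" using assms by (simp add: c_def divide_pos_neg mult_neg_pos)
  interpret N: stable_distribution c \<alpha> \<gamma> N
  proof (intro stable_distribution.intro stable_line.intro stable_distribution_axioms.intro)
    show "real_distribution N" unfolding N_def by (rule X.real_distribution_distr) simp
    show "char N k = stable_mgf c \<alpha> (\<i> * of_real k)" for k
      using X.char_X[of \<tau> k] stable_char_eq_mgf[OF assms(1,2), of \<tau> \<sigma> k] assms(7,9)
      by (simp add: N_def c_def)
  qed (use c assms in \<open>auto simp: \<gamma>_def\<close>)
  have u: "0 < u" "u < \<gamma>" using assms by (auto simp: \<gamma>_def)
  define P where "P x = (if x + y > 0 then exp (u * (x + y)) else 0)" for x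
  have P_meas [measurable]: "P \<in> borel_measurable borel" unfolding P_def by measurable
  have payoff: "power_asset_or_nothing_call u (asset_price X S r \<mu> \<tau> \<omega>) K = K * P (X \<tau> \<omega>)" for \<omega>
    using power_asset_or_nothing_call_eq[OF assms(4,5,6), of r \<mu> \<tau> "X \<tau> \<omega>"] assms(10)
    by (simp add: asset_price_def P_def y_def add.assoc)
  note P_int = N.exponential_payoff[OF u, of y, folded P_def]
  have "integrable M (\<lambda>\<omega>. P (X \<tau> \<omega>))"
    using P_int(1) unfolding N_def by (subst (asm) integrable_distr_eq) auto
  then have int: "integrable M (\<lambda>\<omega>. power_asset_or_nothing_call u (asset_price X S r \<mu> \<tau> \<omega>) K)"
    unfolding payoff by simp
  define a where "a = (\<lambda>n m. rGamma (1 + (real m - real n) / \<alpha>) / fact n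
                 * u ^ m * y ^ n * c powr ((real m - real n) / \<alpha>))"
  have summable_a: "summable (\<lambda>m. a n m)" "summable (\<lambda>n. \<Sum>m. a n m)" for n
    unfolding a_def by (rule N.double_series[OF u])+
  have "complex_of_real (\<Sum>n. \<Sum>m. a n m) = of_real (\<alpha> * (\<integral>x. P x \<partial>N))"
    using N.double_series(3)[OF u, of y] P_int(2) by (simp add: a_def)
  then have "(\<Sum>n. \<Sum>m. a n m) = \<alpha> * (\<integral>x. P x \<partial>N)" by (simp only: of_real_eq_iff)
  moreover have "(\<integral>x. P x \<partial>N) = (\<integral>\<omega>. P (X \<tau> \<omega>) \<partial>M)"
    unfolding N_def by (rule integral_distr) auto
  ultimately have "option_value M X (power_asset_or_nothing_call u) S K r \<mu> \<tau>
      = K * exp (- r * \<tau>) / \<alpha> * (\<Sum>n. \<Sum>m. a n m)"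
    unfolding option_value_def payoff using assms(1) by simp
  then have "integrable M (\<lambda>\<omega>. power_asset_or_nothing_call u (asset_price X S r \<mu> \<tau> \<omega>) K) \<and>
        (\<forall>n. summable (\<lambda>m. a n m)) \<and> summable (\<lambda>n. \<Sum>m. a n m) \<and>
        option_value M X (power_asset_or_nothing_call u) S K r \<mu> \<tau>
          = K * exp (- r * \<tau>) / \<alpha> * (\<Sum>n. \<Sum>m. a n m)"
    using int summable_a by blast
  then show ?thesis unfolding Let_def a_def y_def c_def .
qed

end
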